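(* Let $k \ge 0$ be an integer and let $P$ be a $d$-dimensional smooth Fano polytope with exactly $3d-k$ vertices, where $d \ge 15k^2+37k+2$. Put $f(d,k) := \left\lfloor \frac{d-15k^2-37k}{2}\right\rfloor$. Then $P$ is lattice equivalent to $Q \oplus P_6^{\oplus f(d,k)}$, where $Q$ is a smooth Fano polytope of dimension $d-2f(d,k)$.
   Context: Let $N\cong\mathbb{Z}^d$ be a lattice and $N_{\mathbb{R}}=N\otimes_{\mathbb{Z}}\mathbb{R}$. A smooth Fano polytope $P\subset N_{\mathbb{R}}$ is a full-dimensional lattice polytope (all vertices lie in $N$) containing the origin in its interior such that for every facet $F$ of $P$ the vertex set of $F$ is a lattice basis of $N$. Two smooth Fano polytopes are lattice equivalent if their vertex sets are in bijection by an affine-linear lattice isomorphism. The direct sum of smooth Fano polytopes $Q\subset N_{\mathbb{R}}$, $Q'\subset N'_{\mathbb{R}}$ is $Q\oplus Q' = \operatorname{conv}(Q\times\{0\}\cup\{0\}\times Q')\subset N_{\mathbb{R}}\times N'_{\mathbb{R}}$ (with respect to the lattice $N\times N'$); $P_6^{\oplus m}$ denotes the direct sum of $m$ copies of $P_6$. $P_6\subset\mathbb{R}^2$ is the smooth Fano hexagon with vertices $\pm e_1,\pm e_2,\pm(e_1-e_2)$. The point $\{0\}$ in the $0$-dimensional space is regarded as the $0$-dimensional smooth Fano polytope (so $\{0\}\oplus Q'$ is identified with $Q'$). *)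

theory Defs
  imports "HOL-Analysis.Analysis" "HOL-Analysis.Finite_Function_Topology"
begin

(* A lattice N is a discrete subgroup of a real vector space, and N_R is its real span.  N need not
   have full rank in the type it lives in: this is how lattices of every rank, including 0, are
   obtained although types have a fixed positive dimension. *)

definition lattice_basis :: "'a::real_vector set \<Rightarrow> 'a set \<Rightarrow> bool" where
  "lattice_basis B N \<longleftrightarrow>
     finite B \<and> independent B \<and> N = {x. \<exists>c :: 'a \<Rightarrow> int. x = (\<Sum>b\<in>B. of_int (c b) *\<^sub>R b)}"

definition lattice_of_rank :: "nat \<Rightarrow> 'a::real_vector set \<Rightarrow> bool" where
  "lattice_of_rank d N \<longleftrightarrow> (\<exists>B. lattice_basis B N \<and> card B = d)"

definition vertices :: "'a::real_vector set \<Rightarrow> 'a set" where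
  "vertices P = {v. v extreme_point_of P}"

(* The affine hull of P is all of N_R, so the relative interior of P is its interior in N_R.
   For d = 0 the only such P is {0}, which has no facets. *)

definition smooth_fano :: "nat \<Rightarrow> 'a::euclidean_space set \<Rightarrow> 'a set \<Rightarrow> bool" where
  "smooth_fano d N P \<longleftrightarrow>
     lattice_of_rank d N \<and>
     polytope P \<and> affine hull P = span N \<and> vertices P \<subseteq> N \<and>
     0 \<in> rel_interior P \<and>
     (\<forall>F. F facet_of P \<longrightarrow> lattice_basis (vertices F) N)"

definition lattice_equivalent ::
  "'a::real_vector set \<Rightarrow> 'a set \<Rightarrow> 'b::real_vector set \<Rightarrow> 'b set \<Rightarrow> bool" where
  "lattice_equivalent N P N' P' \<longleftrightarrow>
     (\<exists>A c. linear A \<and> bij_betw (\<lambda>x. A x + c) N N' \<and>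
            bij_betw (\<lambda>x. A x + c) (vertices P) (vertices P'))"

definition direct_sum :: "'a::real_vector set \<Rightarrow> 'b::real_vector set \<Rightarrow> ('a \<times> 'b) set" where
  "direct_sum Q Q' = convex hull (Q \<times> {0} \<union> {0} \<times> Q')"

(* An m-fold iterated product has a type depending on m.  Instead, the m copies of 'a are the
   coordinates 0, ..., m - 1 of the space of finitely supported sequences in 'a, and append_coord m
   identifies (m coordinates) x (one coordinate) with m + 1 coordinates. *)

definition append_coord ::
  "nat \<Rightarrow> (nat, 'a::real_vector) poly_mapping \<times> 'a \<Rightarrow> (nat, 'a) poly_mapping" where
  "append_coord m = (\<lambda>(x, y). x + Poly_Mapping.single m y)"

primrec lattice_power :: "nat \<Rightarrow> 'a::real_vector set \<Rightarrow> (nat, 'a) poly_mapping set" where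
  "lattice_power 0 N = {0}"
| "lattice_power (Suc m) N = append_coord m ` (lattice_power m N \<times> N)"

primrec direct_sum_power :: "nat \<Rightarrow> 'a::real_vector set \<Rightarrow> (nat, 'a) poly_mapping set" where
  "direct_sum_power 0 P = {0}"
| "direct_sum_power (Suc m) P = append_coord m ` direct_sum (direct_sum_power m P) P"

definition P6_lattice :: "(real \<times> real) set" where
  "P6_lattice = \<int> \<times> \<int>"

definition P6 :: "(real \<times> real) set" where
  "P6 = convex hull {(1, 0), (-1, 0), (0, 1), (0, -1), (1, -1), (-1, 1)}"

(* The argument of nat is nonnegative whenever d \<ge> 15 * k^2 + 37 * k. *)

definition num_P6 :: "nat \<Rightarrow> nat \<Rightarrow> nat" where
  "num_P6 d k = nat \<lfloor>(real d - 15 * (real k)\<^sup>2 - 37 * real k) / 2\<rfloor>"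

end

theory Submission
  imports Defs
begin

text \<open>
  Fix a facet whose cone contains the sum of all vertices, with vertices \<open>e\<^sub>1, \<dots>, e\<^sub>d\<close>, and let \<open>u\<close> be the sum
  of the coordinates in this basis.  Vertices with \<open>u = 0\<close> have pairwise disjoint negative supports, so there
  are at most \<open>d\<close> of them, and the sum of \<open>u\<close> over all vertices is nonnegative.  With \<open>3d - k\<close>
  vertices, both estimates are sharp up to \<open>k\<close>: all but \<open>O(k)\<close> indices \<open>i\<close> have a vertex \<open>e\<^sub>j - e\<^sub>i\<close>, and
  there are at least \<open>d - 2k\<close> vertices with \<open>u = -1\<close>.  Comparing with the adjacent facets shows that all but
  \<open>O(k\<^sup>2)\<close> of the latter are of the form \<open>- e\<^sub>i\<close>.  Since each coordinate of the sum of all vertices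
  is nonnegative and their total is at most \<open>k\<close>, for all but \<open>O(k\<^sup>2)\<close> indices \<open>i\<close> the vertices with nonzero
  \<open>i\<close>-th coordinate are exactly \<open>\<plusminus>e\<^sub>i\<close> and \<open>\<plusminus>(e\<^sub>i - e\<^sub>j)\<close>, where \<open>i\<close> and \<open>j\<close> play symmetric roles.
  Each such pair of indices splits off a hexagon.
\<close>

subsection \<open>Coordinates in a lattice basis\<close>

text \<open>The basic move passes from a facet to the adjacent one at \<open>e\<close>. The new
  vertex has \<open>e\<close>-coordinate -1, so the depth of any vertex \<open>v\<close> changes by
  a positive multiple of \<open>crd E e v\<close>. As depths stay nonnegative, a vertex with u = 0
  that is negative at \<open>e\<close> must be the new vertex itself; this is the source of the
  disjoint supports. If the new vertex has u = 0, the move turns a vertex with u = -1 and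
  \<open>e\<close>-coordinate -1 into one of level 0, and disjointness applies again in the adjacent
  facet. The number k enters through the identity \<open>balance\<close> alone: the coordinates of
  the sum of all vertices, the shortage of vertices with u = 0 and the surplus depth below u = -1
  add up to k. The obstacle is a vertex with u = -1 that is negative at one of the at most 2k
  indices without an arrow. Each such index admits as many of these vertices as there are such
  indices, hence the square of k. The losses come to at most 12k^2 + 22k indices, within the 15k^2 +
  37k of the statement. Any choice of disjoint pairs splits off, so exactly f(d,k) of them are taken
  and the others stay in Q.\<close>

definition crd :: "'a::real_vector set \<Rightarrow> 'a \<Rightarrow> 'a \<Rightarrow> int" where
  "crd E e x = \<lfloor>representation E x e\<rfloor>"

lemma crd_eqI:
  assumes "finite E" "independent E" "x = (\<Sum>e\<in>E. of_int (c e) *\<^sub>R e)" "e \<in> E"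
  shows "crd E e x = c e"
proof -
  have "representation E x = (\<lambda>e. if e \<in> E then of_int (c e) else 0)"
    using assms by (intro representation_eqI) (auto simp: span_sum span_scale span_base sum.If_cases intro!: sum.mono_neutral_cong_left split: if_splits)
  then show ?thesis using assms by (simp add: crd_def)
qed

lemma lattice_basis_crd:
  assumes "lattice_basis E N" "x \<in> N"
  shows "x = (\<Sum>e\<in>E. of_int (crd E e x) *\<^sub>R e)"
proof -
  from assms obtain c where c: "x = (\<Sum>e\<in>E. of_int (c e) *\<^sub>R e)" by (auto simp: lattice_basis_def)
  have "crd E e x = c e" if "e \<in> E" for e
    using assms c that by (intro crd_eqI) (auto simp: lattice_basis_def)
  then show ?thesis using c by simp
qed

lemma crd_unique:
  assumes "lattice_basis E N" "x = (\<Sum>e\<in>E. of_int (c e) *\<^sub>R e)" "e \<in> E"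
  shows "crd E e x = c e"
  using assms by (intro crd_eqI) (auto simp: lattice_basis_def)

lemma crd_basis:
  assumes "lattice_basis E N" "f \<in> E" "e \<in> E"
  shows "crd E e f = (if e = f then 1 else 0)"
  using assms
  by (intro crd_unique) (auto simp: lattice_basis_def if_distrib[of of_int] if_distrib[of "\<lambda>x. x *\<^sub>R _"] sum.If_cases cong: if_cong)

lemma lattice_basis_subset: "lattice_basis E N \<Longrightarrow> e \<in> E \<Longrightarrow> e \<in> N"
proof -
  assume a: "lattice_basis E N" "e \<in> E"
  have "e = (\<Sum>b\<in>E. of_int (if b = e then 1 else 0) *\<^sub>R b)"
    using a by (auto simp: lattice_basis_def if_distrib[of of_int] if_distrib[of "\<lambda>x. x *\<^sub>R _"] sum.If_cases cong: if_cong)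
  then show ?thesis using a by (auto simp: lattice_basis_def)
qed

lemma crd_lincomb:
  assumes "lattice_basis E N" "x \<in> N" "y \<in> N" "e \<in> E"
  shows "crd E e (of_int a *\<^sub>R x + of_int b *\<^sub>R y) = a * crd E e x + b * crd E e y"
proof (rule crd_unique[OF assms(1) _ assms(4)])
  have "of_int a *\<^sub>R x + of_int b *\<^sub>R y =
    of_int a *\<^sub>R (\<Sum>e\<in>E. of_int (crd E e x) *\<^sub>R e) + of_int b *\<^sub>R (\<Sum>e\<in>E. of_int (crd E e y) *\<^sub>R e)"
    using lattice_basis_crd[OF assms(1,2)] lattice_basis_crd[OF assms(1,3)] by simp
  also have "\<dots> = (\<Sum>e\<in>E. of_int (a * crd E e x + b * crd E e y) *\<^sub>R e)"
    by (simp add: scaleR_sum_right scaleR_add_left sum.distrib)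
  finally show "of_int a *\<^sub>R x + of_int b *\<^sub>R y = (\<Sum>e\<in>E. of_int (a * crd E e x + b * crd E e y) *\<^sub>R e)" .
qed

lemmas crd_diff = crd_lincomb[where a = 1 and b = "-1", simplified]

lemma crd_minus:
  assumes "lattice_basis E N" "x \<in> N" "e \<in> E"
  shows "crd E e (- x) = - crd E e x"
  using crd_lincomb[OF assms(1,2,2,3), of "-1" 0] by simp

lemma crd_sum:
  assumes b: "lattice_basis E N" "\<And>v. v \<in> V \<Longrightarrow> v \<in> N" and e: "e \<in> E"
  shows "crd E e (\<Sum>V) = (\<Sum>v\<in>V. crd E e v)"
proof (rule crd_unique[OF b(1) _ e])
  have "(\<Sum>v\<in>V. v) = (\<Sum>v\<in>V. \<Sum>e\<in>E. of_int (crd E e v) *\<^sub>R e)"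
    by (rule sum.cong[OF refl]) (rule lattice_basis_crd[OF b])
  also have "\<dots> = (\<Sum>e\<in>E. of_int (\<Sum>v\<in>V. crd E e v) *\<^sub>R e)"
    by (subst sum.swap) (simp add: scaleR_sum_left)
  finally show "\<Sum>V = (\<Sum>e\<in>E. of_int (\<Sum>v\<in>V. crd E e v) *\<^sub>R e)" .
qed

lemma lattice_basis_span:
  assumes "lattice_basis E N"
  shows "span E = span N"
proof (rule antisym)
  show "span E \<subseteq> span N"
    using lattice_basis_subset[OF assms] by (intro span_mono) auto
  have "N \<subseteq> span E"
    using assms by (auto simp: lattice_basis_def intro!: span_sum span_scale intro: span_base)
  then show "span N \<subseteq> span E" by (simp add: span_minimal)
qed

lemma lattice_basis_card:
  assumes "lattice_basis E N" "lattice_basis E' N"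
  shows "card E = card E'"
proof -
  have "independent E" "independent E'" using assms by (auto simp: lattice_basis_def)
  then have "dim (span E) = card E" "dim (span E') = card E'" by (auto simp: dim_span_eq_card_independent simp del: dim_span)
  then show ?thesis using lattice_basis_span[OF assms(1)] lattice_basis_span[OF assms(2)] by simp
qed

lemma lattice_of_rank_card: "lattice_of_rank d N \<Longrightarrow> lattice_basis E N \<Longrightarrow> card E = d"
  using lattice_basis_card by (auto simp: lattice_of_rank_def)

lemma lattice_basis_memI: "lattice_basis E N \<Longrightarrow> (\<Sum>e\<in>E. of_int (c e) *\<^sub>R e) \<in> N"
  by (auto simp: lattice_basis_def)

lemma lattice_lincomb:
  assumes "lattice_basis E N" "x \<in> N" "y \<in> N"
  shows "of_int a *\<^sub>R x + of_int b *\<^sub>R y \<in> N"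
proof -
  have "of_int a *\<^sub>R x + of_int b *\<^sub>R y =
    of_int a *\<^sub>R (\<Sum>e\<in>E. of_int (crd E e x) *\<^sub>R e) + of_int b *\<^sub>R (\<Sum>e\<in>E. of_int (crd E e y) *\<^sub>R e)"
    using lattice_basis_crd[OF assms(1,2)] lattice_basis_crd[OF assms(1,3)] by simp
  also have "\<dots> = (\<Sum>e\<in>E. of_int (a * crd E e x + b * crd E e y) *\<^sub>R e)"
    by (simp add: scaleR_sum_right scaleR_add_left sum.distrib)
  finally have eq: "of_int a *\<^sub>R x + of_int b *\<^sub>R y = (\<Sum>e\<in>E. of_int (a * crd E e x + b * crd E e y) *\<^sub>R e)" .
  show ?thesis unfolding eq by (rule lattice_basis_memI[OF assms(1)])
qed

lemma lattice_zero: "lattice_basis E N \<Longrightarrow> 0 \<in> N"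
  using lattice_basis_memI[of E N "\<lambda>_. 0"] by simp

lemma lattice_sum:
  assumes "lattice_basis E N" "\<And>i. i \<in> I \<Longrightarrow> f i \<in> N"
  shows "(\<Sum>i\<in>I. of_int (c i) *\<^sub>R f i) \<in> N"
  using assms(2)
proof (induction I rule: infinite_finite_induct)
  case (insert i I)
  have a: "f i \<in> N" by (rule insert.prems) simp
  have b: "(\<Sum>i\<in>I. of_int (c i) *\<^sub>R f i) \<in> N" by (rule insert.IH) (rule insert.prems, simp)
  have "(\<Sum>i\<in>insert i I. of_int (c i) *\<^sub>R f i) = of_int (c i) *\<^sub>R f i + of_int 1 *\<^sub>R (\<Sum>i\<in>I. of_int (c i) *\<^sub>R f i)"
    by (simp add: sum.insert[OF insert.hyps])
  with lattice_lincomb[OF assms(1) a b, of "c i" 1] show ?case by argo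
qed (use lattice_zero[OF assms(1)] in auto)

text \<open>\<open>crd\<close> is a floor and need not be linear off the lattice. These real
  functionals agree with it on \<open>N\<close>; they supply the supporting functionals and the
  coordinates of the projection \<open>pr\<close>.\<close>

lemma dual_functionals:
  fixes E :: "'a::real_vector set"
  assumes "lattice_basis E N"
  obtains g :: "'a \<Rightarrow> 'a \<Rightarrow> real" where "\<And>e. linear (g e)" "\<And>e x. e \<in> E \<Longrightarrow> x \<in> N \<Longrightarrow> g e x = of_int (crd E e x)"
proof -
  have ind: "independent E" "finite E" using assms by (auto simp: lattice_basis_def)
  have ex: "\<exists>g. linear g \<and> (\<forall>x\<in>E. g x = (if x = e then 1 else 0 :: real))" for e
    by (rule linear_independent_extend[OF ind(1)])
  define g where "g e = (SOME g. linear g \<and> (\<forall>x\<in>E. g x = (if x = e then 1 else 0 :: real)))" for e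
  have g: "linear (g e)" "x \<in> E \<Longrightarrow> g e x = (if x = e then 1 else 0 :: real)" for e x
    using someI_ex[OF ex[of e]] unfolding g_def by blast+
  have "g e x = of_int (crd E e x)" if "e \<in> E" "x \<in> N" for e x
  proof -
    interpret linear "g e" by (rule g)
    have "g e x = g e (\<Sum>j\<in>E. of_int (crd E j x) *\<^sub>R j)"
      using lattice_basis_crd[OF assms that(2)] by simp
    also have "\<dots> = (\<Sum>j\<in>E. of_int (crd E j x) * g e j)" by (simp add: sum scale)
    also have "\<dots> = (\<Sum>j\<in>E. if j = e then of_int (crd E j x) else 0)"
      by (rule sum.cong[OF refl]) (simp add: g(2))
    also have "\<dots> = of_int (crd E e x)" using that ind by simp
    finally show ?thesis .
  qed
  then show ?thesis by (rule that[OF g(1)])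
qed

subsection \<open>Passing to adjacent facets\<close>

text \<open>
  If \<open>E\<close> is the vertex set of a facet and \<open>u\<close> the functional with value 1 on it, then
  \<open>depth E v = 1 - u(v)\<close>; the paper's level of \<open>v\<close> is \<open>u(v)\<close>.
\<close>

definition depth :: "'a::real_vector set \<Rightarrow> 'a \<Rightarrow> int" where
  "depth E v = 1 - (\<Sum>e\<in>E. crd E e v)"

text \<open>
  \<open>Fr\<close> stands for the vertex sets of the facets.  All combinatorial arguments only use that
  facets are lattice bases, that vertices have depth at least 0, and the exchange property across a ridge.
\<close>

locale fano_frames =
  fixes N V :: "'a::real_vector set" and Fr :: "'a set set"
  assumes finite_V: "finite V"
    and V_subset_N: "V \<subseteq> N"
    and frame_subset: "E \<in> Fr \<Longrightarrow> E \<subseteq> V"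
    and frame_basis: "E \<in> Fr \<Longrightarrow> lattice_basis E N"
    and depth_nonneg: "E \<in> Fr \<Longrightarrow> v \<in> V \<Longrightarrow> 0 \<le> depth E v"
    and depth_0D: "E \<in> Fr \<Longrightarrow> v \<in> V \<Longrightarrow> depth E v = 0 \<Longrightarrow> v \<in> E"
    and pivot: "E \<in> Fr \<Longrightarrow> e \<in> E \<Longrightarrow> \<exists>e'\<in>V - E. insert e' (E - {e}) \<in> Fr"
begin

definition neighbour :: "'a set \<Rightarrow> 'a \<Rightarrow> 'a" where
  "neighbour E e = (SOME e'. e' \<in> V - E \<and> insert e' (E - {e}) \<in> Fr)"

abbreviation flip :: "'a set \<Rightarrow> 'a \<Rightarrow> 'a set" where
  "flip E e \<equiv> insert (neighbour E e) (E - {e})"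

lemma neighbour:
  assumes "E \<in> Fr" "e \<in> E"
  shows "neighbour E e \<in> V" "neighbour E e \<notin> E" "flip E e \<in> Fr"
proof -
  have "\<exists>e'. e' \<in> V - E \<and> insert e' (E - {e}) \<in> Fr" using pivot[OF assms] by blast
  from someI_ex[OF this] show "neighbour E e \<in> V" "neighbour E e \<notin> E" "flip E e \<in> Fr"
    unfolding neighbour_def by auto
qed

lemma finite_frame: "E \<in> Fr \<Longrightarrow> finite E"
  using frame_basis by (auto simp: lattice_basis_def)

lemma crd_frame: "E \<in> Fr \<Longrightarrow> f \<in> E \<Longrightarrow> e \<in> E \<Longrightarrow> crd E e f = (if e = f then 1 else 0)"
  using frame_basis crd_basis by blast

lemma depth_frame: "E \<in> Fr \<Longrightarrow> e \<in> E \<Longrightarrow> depth E e = 0"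
  using finite_frame crd_frame by (simp add: depth_def)

lemma depth_pos: "E \<in> Fr \<Longrightarrow> v \<in> V \<Longrightarrow> v \<notin> E \<Longrightarrow> 1 \<le> depth E v"
  using depth_nonneg depth_0D by (metis int_one_le_iff_zero_less order_le_less)

text \<open>Write \<open>e\<close> in the flipped basis and expand the new vertex in
  \<open>E\<close>: only the new vertex contributes to the coefficient of \<open>e\<close>. The
  coordinate is therefore an invertible integer.\<close>

lemma crd_neighbour_unit:
  assumes E: "E \<in> Fr" "e \<in> E"
  shows "crd E e (neighbour E e) * crd (flip E e) (neighbour E e) e = 1"
proof -
  define e' where "e' = neighbour E e"
  note E' = neighbour[OF E]
  have bas: "lattice_basis E N" "lattice_basis (flip E e) N"
    using frame_basis E(1) E'(3) by auto
  have fin: "finite E" using finite_frame E by auto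
  have eN: "e \<in> N" using E V_subset_N frame_subset by blast
  have e'N: "e' \<in> N" using E' V_subset_N e'_def by auto
  have ne: "e' \<notin> E" using E' e'_def by simp
  have "e = (\<Sum>j\<in>flip E e. of_int (crd (flip E e) j e) *\<^sub>R j)"
    by (rule lattice_basis_crd[OF bas(2) eN])
  also have "\<dots> = of_int (crd (flip E e) e' e) *\<^sub>R e' + (\<Sum>j\<in>E-{e}. of_int (crd (flip E e) j e) *\<^sub>R j)"
    using fin ne by (simp add: e'_def)
  also have "of_int (crd (flip E e) e' e) *\<^sub>R e' = of_int (crd (flip E e) e' e) *\<^sub>R (\<Sum>j\<in>E. of_int (crd E j e') *\<^sub>R j)"
    using lattice_basis_crd[OF bas(1) e'N] by simp
  finally have eq: "e = of_int (crd (flip E e) e' e) *\<^sub>R (\<Sum>j\<in>E. of_int (crd E j e') *\<^sub>R j) + (\<Sum>j\<in>E-{e}. of_int (crd (flip E e) j e) *\<^sub>R j)"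
    by (simp add: e'_def)
  have "e = (\<Sum>j\<in>E. of_int (crd (flip E e) e' e * crd E j e' + (if j = e then 0 else crd (flip E e) j e)) *\<^sub>R j)"
    apply (subst eq)
    using fin E(2)
    by (simp add: scaleR_sum_right scaleR_add_left sum.distrib if_distrib[of of_int] if_distrib[of "\<lambda>x. x *\<^sub>R _"]
        sum.If_cases Int_def set_diff_eq cong: if_cong)
  from crd_unique[OF bas(1) this E(2)] crd_frame[OF E(1) E(2) E(2)]
  show ?thesis by (simp add: e'_def mult.commute)
qed

text \<open>The coordinate of the new vertex at \<open>e\<close> is a unit \<open>s\<close>, so its
  expansion can be solved for \<open>e\<close> over the integers, which gives all new coordinates.
  Nonnegative depth then decides the sign.\<close>

lemma crd_neighbour:
  assumes E: "E \<in> Fr" "e \<in> E"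
  shows "crd E e (neighbour E e) = -1"
    and crd_flip_self: "v \<in> N \<Longrightarrow> crd (flip E e) (neighbour E e) v = - crd E e v"
    and crd_flip: "v \<in> N \<Longrightarrow> j \<in> E \<Longrightarrow> j \<noteq> e \<Longrightarrow> crd (flip E e) j v = crd E j v + crd E e v * crd E j (neighbour E e)"
    and depth_flip: "v \<in> N \<Longrightarrow> depth (flip E e) v = depth E v + depth E (neighbour E e) * crd E e v"
proof -
  define e' where "e' = neighbour E e"
  note E' = neighbour[OF E]
  have bas: "lattice_basis E N" "lattice_basis (flip E e) N"
    using frame_basis E(1) E'(3) by auto
  have fin: "finite E" using finite_frame E by auto
  have eN: "e \<in> N" using E V_subset_N frame_subset by blast
  have e'N: "e' \<in> N" using E' V_subset_N e'_def by auto
  have ne: "e' \<notin> E" using E' e'_def by simp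
  define s where "s = crd E e e'"
  have s: "s * s = 1" "s = 1 \<or> s = -1"
    using crd_neighbour_unit[OF E] by (auto simp: s_def e'_def zmult_eq_1_iff)
  have e'_exp: "e' = of_int s *\<^sub>R e + (\<Sum>j\<in>E-{e}. of_int (crd E j e') *\<^sub>R j)"
  proof -
    have "e' = (\<Sum>j\<in>E. of_int (crd E j e') *\<^sub>R j)" by (rule lattice_basis_crd[OF bas(1) e'N])
    also have "\<dots> = of_int s *\<^sub>R e + (\<Sum>j\<in>E-{e}. of_int (crd E j e') *\<^sub>R j)"
      using fin E(2) by (subst sum.remove[of E e]) (auto simp: s_def)
    finally show ?thesis .
  qed
  have "real_of_int s *\<^sub>R e' = real_of_int s *\<^sub>R (of_int s *\<^sub>R e + (\<Sum>j\<in>E-{e}. of_int (crd E j e') *\<^sub>R j))"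
    using e'_exp by simp
  then have "real_of_int s *\<^sub>R e' = real_of_int (s * s) *\<^sub>R e + real_of_int s *\<^sub>R (\<Sum>j\<in>E-{e}. of_int (crd E j e') *\<^sub>R j)"
    by (simp add: scaleR_add_right)
  then have e_exp: "e = of_int s *\<^sub>R e' - of_int s *\<^sub>R (\<Sum>j\<in>E-{e}. of_int (crd E j e') *\<^sub>R j)"
    using s by (simp del: of_int_mult)
  have gen: "crd (flip E e) j v = (if j = e' then s * crd E e v else crd E j v - s * crd E e v * crd E j e')"
    if v: "v \<in> N" and j: "j \<in> flip E e" for v j
  proof (rule crd_unique[OF bas(2) _ j])
    have "v = (\<Sum>j\<in>E. of_int (crd E j v) *\<^sub>R j)" by (rule lattice_basis_crd[OF bas(1) v])
    also have "\<dots> = of_int (crd E e v) *\<^sub>R e + (\<Sum>j\<in>E-{e}. of_int (crd E j v) *\<^sub>R j)"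
      using fin E(2) by (subst sum.remove[of E e]) auto
    also have "of_int (crd E e v) *\<^sub>R e = of_int (crd E e v) *\<^sub>R (of_int s *\<^sub>R e' - of_int s *\<^sub>R (\<Sum>j\<in>E-{e}. of_int (crd E j e') *\<^sub>R j))"
      using e_exp by simp
    finally have "v = of_int (s * crd E e v) *\<^sub>R e' + (\<Sum>j\<in>E-{e}. of_int (crd E j v - s * crd E e v * crd E j e') *\<^sub>R j)"
      by (simp add: scaleR_diff_right scaleR_left_diff_distrib sum_subtractf scaleR_sum_right mult.assoc mult.left_commute mult.commute add_diff_eq diff_add_eq)
    also have "\<dots> = (\<Sum>j\<in>flip E e. of_int (if j = e' then s * crd E e v else crd E j v - s * crd E e v * crd E j e') *\<^sub>R j)"
      using fin ne by (auto simp: e'_def[symmetric] intro!: sum.cong split: if_split_asm)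
    finally show "v = (\<Sum>j\<in>flip E e. of_int (if j = e' then s * crd E e v else crd E j v - s * crd E e v * crd E j e') *\<^sub>R j)" .
  qed
  have split: "(\<Sum>j\<in>E. crd E j v) = crd E e v + (\<Sum>j\<in>E-{e}. crd E j v)" for v
    using fin E(2) by (subst sum.remove[of E e]) auto
  have dep: "depth (flip E e) v = depth E v + crd E e v * (- s * depth E e')"
    if v: "v \<in> N" for v
  proof -
    have "(\<Sum>j\<in>flip E e. crd (flip E e) j v) = s * crd E e v + (\<Sum>j\<in>E-{e}. crd E j v - s * crd E e v * crd E j e')"
      using fin ne gen[OF v] by (auto simp: e'_def[symmetric] intro!: sum.cong split: if_split_asm)
    also have "\<dots> = s * crd E e v + (\<Sum>j\<in>E-{e}. crd E j v) - s * crd E e v * (\<Sum>j\<in>E-{e}. crd E j e')"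
      by (simp add: sum_subtractf sum_distrib_left)
    finally have 1: "(\<Sum>j\<in>flip E e. crd (flip E e) j v) = \<dots>" .
    have 2: "(\<Sum>j\<in>E-{e}. crd E j v) = 1 - depth E v - crd E e v" "(\<Sum>j\<in>E-{e}. crd E j e') = 1 - depth E e' - s"
      using split[of v] split[of e'] by (simp_all add: depth_def s_def)
    have 3: "s * (s * crd E e v) = crd E e v" using s(1) by (simp flip: mult.assoc)
    have "s * crd E e v + (1 - depth E v - crd E e v) - s * crd E e v * (1 - depth E e' - s) =
      1 - depth E v - crd E e v + s * (s * crd E e v) + s * depth E e' * crd E e v"
      by (simp add: algebra_simps)
    with 1 3 have "(\<Sum>j\<in>flip E e. crd (flip E e) j v) = 1 - depth E v + s * depth E e' * crd E e v"
      unfolding 2 by linarith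
    then show ?thesis unfolding depth_def[of "flip E e"] by simp
  qed
  \<comment> \<open>For \<open>s = 1\<close> the old vertex \<open>e\<close> would have negative
    depth in the flipped frame, that is, lie beyond the adjacent facet.\<close>
  have "s \<noteq> 1"
  proof
    assume "s = 1"
    with dep[OF eN] depth_frame[OF E] crd_frame[OF E(1) E(2) E(2)] depth_nonneg[OF E'(3), of e]
      depth_pos[OF E(1) E'(1,2)] frame_subset[OF E(1)] E(2)
    show False by (auto simp: e'_def)
  qed
  with s have s': "s = -1" by simp
  show "crd E e (neighbour E e) = -1" using s' by (simp add: s_def e'_def)
  show "v \<in> N \<Longrightarrow> crd (flip E e) (neighbour E e) v = - crd E e v"
    using gen[of v e'] s' by (simp add: e'_def)
  show "v \<in> N \<Longrightarrow> j \<in> E \<Longrightarrow> j \<noteq> e \<Longrightarrow> crd (flip E e) j v = crd E j v + crd E e v * crd E j (neighbour E e)"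
    using gen[of v j] s' ne by (auto simp: e'_def)
  show "v \<in> N \<Longrightarrow> depth (flip E e) v = depth E v + depth E (neighbour E e) * crd E e v"
    using dep[of v] s' by (simp add: e'_def mult.commute)
qed

section \<open>Negative coordinates of vertices of small depth\<close>

lemma V_N: "v \<in> V \<Longrightarrow> v \<in> N"
  using V_subset_N by blast

lemma frame_N: "E \<in> Fr \<Longrightarrow> e \<in> E \<Longrightarrow> e \<in> N"
  using frame_subset V_N by blast

text \<open>After the flip at \<open>e\<close> the depth is 1 minus a product of two positive
  integers and still nonnegative, hence 0: \<open>v\<close> belongs to the adjacent facet but not to
  \<open>E\<close>. So distinct vertices of depth 1 are never negative at the same index.\<close>

lemma level0_neg:
  assumes "E \<in> Fr" "v \<in> V" "depth E v = 1" "e \<in> E" "crd E e v < 0"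
  shows "crd E e v = -1" "v = neighbour E e"
proof -
  note n = neighbour[OF assms(1,4)]
  have c: "1 \<le> depth E (neighbour E e)" using depth_pos[OF assms(1) n(1,2)] .
  have d: "depth (flip E e) v = 1 + depth E (neighbour E e) * crd E e v"
    using depth_flip[OF assms(1,4) V_N[OF assms(2)]] assms(3) by simp
  have "0 \<le> depth (flip E e) v" using depth_nonneg[OF n(3) assms(2)] .
  moreover have "depth E (neighbour E e) * crd E e v \<le> crd E e v"
    using c assms(5) by (simp add: mult_le_cancel_right2)
  ultimately show neg: "crd E e v = -1" using d assms(5) by linarith
  have "depth (flip E e) v = 0"
    using d c neg \<open>0 \<le> depth (flip E e) v\<close> by simp
  then have "v \<in> flip E e" using depth_0D[OF n(3) assms(2)] by simp
  moreover have "v \<notin> E" using depth_frame[OF assms(1)] assms(3) by force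
  ultimately show "v = neighbour E e" by auto
qed

text \<open>The flip at \<open>e\<close> lowers the depth by at least the size of a negative
  coordinate at \<open>e\<close>.\<close>

lemma crd_ge_neg_depth:
  assumes "E \<in> Fr" "v \<in> V" "e \<in> E"
  shows "- depth E v \<le> crd E e v"
proof (cases "crd E e v < 0")
  case True
  note n = neighbour[OF assms(1,3)]
  have c: "1 \<le> depth E (neighbour E e)" using depth_pos[OF assms(1) n(1,2)] .
  have "0 \<le> depth E v + depth E (neighbour E e) * crd E e v"
    using depth_flip[OF assms(1,3) V_N[OF assms(2)]] depth_nonneg[OF n(3) assms(2)] by simp
  moreover have "depth E (neighbour E e) * crd E e v \<le> crd E e v"
    using c True by (simp add: mult_le_cancel_right2)
  ultimately show ?thesis by linarith
next
  case False
  then show ?thesis using depth_nonneg[OF assms(1,2)] by linarith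
qed

text \<open>After the flip the depth is \<open>2 - c * t\<close> with \<open>c\<close> and
  \<open>t\<close> at least 1. The case \<open>t = 2\<close> would make \<open>v\<close> the
  neighbour, whose depth is then \<open>c = 1\<close> instead of 2.\<close>

lemma level1_neg:
  assumes "E \<in> Fr" "v \<in> V" "depth E v = 2" "e \<in> E" "crd E e v < 0"
  shows "crd E e v = -1" "depth E (neighbour E e) = 1 \<or> v = neighbour E e"
proof -
  note n = neighbour[OF assms(1,4)]
  define c where "c = depth E (neighbour E e)"
  define t where "t = - crd E e v"
  have c: "1 \<le> c" using depth_pos[OF assms(1) n(1,2)] c_def by simp
  have t: "1 \<le> t" using assms(5) t_def by simp
  have d: "depth (flip E e) v = 2 - c * t"
    using depth_flip[OF assms(1,4) V_N[OF assms(2)]] assms(3) by (simp add: c_def t_def)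
  have ge: "c * t \<le> 2" using d depth_nonneg[OF n(3) assms(2)] by simp
  have vE: "v \<notin> E" using depth_frame[OF assms(1)] assms(3) by force
  have eq: "v = neighbour E e" if "c * t = 2"
    using that d depth_0D[OF n(3) assms(2)] vE by auto
  have "t \<le> c * t" "c \<le> c * t" using c t by (simp_all add: mult_le_cancel_right1 mult_le_cancel_left1)
  then have "t = 1 \<and> (c = 1 \<or> c * t = 2) \<or> t = 2 \<and> c = 1"
    using c t ge mult_mono[of 2 c 2 t] by (cases "t = 1"; cases "c = 1") auto
  moreover have "\<not> (t = 2 \<and> c = 1)"
    using eq assms(3) c_def by auto
  ultimately show "crd E e v = -1" "depth E (neighbour E e) = 1 \<or> v = neighbour E e"
    using eq by (auto simp: t_def c_def)
qed

text \<open>An arrow is a vertex of depth 1 with a single negative coordinate, namely at its tail.\<close>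

definition arrow :: "'a set \<Rightarrow> 'a \<Rightarrow> 'a \<Rightarrow> bool" where
  "arrow E e c \<longleftrightarrow> e \<in> E \<and> c \<in> E \<and> c \<noteq> e \<and> c - e \<in> V"

lemma crd_difference:
  assumes "E \<in> Fr" "e \<in> E" "c \<in> E" "j \<in> E"
  shows "crd E j (c - e) = (if j = c then 1 else 0) - (if j = e then 1 else 0)"
  using assms by (simp add: crd_diff[OF frame_basis] frame_N crd_frame)

lemma crd_neg_frame:
  assumes "E \<in> Fr" "e \<in> E" "j \<in> E"
  shows "crd E j (- e) = (if j = e then -1 else 0)"
  using assms by (simp add: crd_minus[OF frame_basis] frame_N crd_frame)

lemma arrowD:
  assumes "E \<in> Fr" "arrow E e c"
  shows "depth E (c - e) = 1" "neighbour E e = c - e"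
proof -
  have a: "e \<in> E" "c \<in> E" "c \<noteq> e" "c - e \<in> V" using assms(2) by (auto simp: arrow_def)
  have "(\<Sum>j\<in>E. crd E j (c - e)) = (\<Sum>j\<in>E. (if j = c then 1 else 0) - (if j = e then 1 else 0))"
    using crd_difference[OF assms(1) a(1,2)] by simp
  then show d: "depth E (c - e) = 1"
    using finite_frame[OF assms(1)] a by (simp add: depth_def sum_subtractf)
  have "crd E e (c - e) = -1" using crd_difference[OF assms(1) a(1,2,1)] a by simp
  then show "neighbour E e = c - e"
    using level0_neg(2)[OF assms(1) a(4) d a(1)] by simp
qed

lemma arrow_unique: "E \<in> Fr \<Longrightarrow> arrow E e c \<Longrightarrow> arrow E e c' \<Longrightarrow> c = c'"
  using arrowD(2) by (metis diff_add_cancel)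

text \<open>The new vertex is \<open>c - e\<close>, of depth 1, so the substitution
  \<open>e = c - (c - e)\<close> changes only the coordinate at the head. Flips at tails are thereby
  explicit, whereas elsewhere little is known about the neighbour.\<close>

lemma arrow_flip:
  assumes "E \<in> Fr" "arrow E e c" "v \<in> N"
  shows "depth (flip E e) v = depth E v + crd E e v"
    "j \<in> E \<Longrightarrow> j \<noteq> e \<Longrightarrow> crd (flip E e) j v = crd E j v + (if j = c then crd E e v else 0)"
proof -
  have a: "e \<in> E" "c \<in> E" "c \<noteq> e" "c - e \<in> V" using assms(2) by (auto simp: arrow_def)
  show "depth (flip E e) v = depth E v + crd E e v"
    using depth_flip[OF assms(1) a(1) assms(3)] arrowD[OF assms(1,2)] by simp
  show "j \<in> E \<Longrightarrow> j \<noteq> e \<Longrightarrow> crd (flip E e) j v = crd E j v + (if j = c then crd E e v else 0)"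
    using crd_flip[OF assms(1) a(1) assms(3)] arrowD[OF assms(1,2)] crd_difference[OF assms(1) a(1,2)] by simp
qed

lemma arrow_in: "arrow E e c \<Longrightarrow> e \<in> E" "arrow E e c \<Longrightarrow> c \<in> E" "arrow E e c \<Longrightarrow> c \<noteq> e" "arrow E e c \<Longrightarrow> c - e \<in> V"
  by (auto simp: arrow_def)

text \<open>After the flip at \<open>i\<close> the vertex has depth 1, so its coordinates are at
  least -1, while the one at \<open>c\<close> has dropped by 1.\<close>

lemma level1_head_nonneg:
  assumes "E \<in> Fr" "arrow E i c" "v \<in> V" "depth E v = 2" "crd E i v = -1"
  shows "0 \<le> crd E c v"
proof -
  have "depth (flip E i) v = 1" "crd (flip E i) c v = crd E c v - 1"
    using arrow_flip[OF assms(1,2) V_N[OF assms(3)]] assms arrow_in[OF assms(2)] by auto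
  moreover have "- depth (flip E i) v \<le> crd (flip E i) c v"
    using neighbour(3)[OF assms(1)] arrow_in[OF assms(2)] assms by (intro crd_ge_neg_depth) auto
  ultimately show ?thesis by simp
qed

text \<open>The flip at \<open>i\<close> brings \<open>v\<close> to depth 1 and leaves
  \<open>w\<close> there, and distinct vertices of depth 1 have disjoint negative supports. The flip
  also lowers \<open>v\<close> at \<open>c\<close> by 1, hence the sharper bound at the
  head.\<close>

lemma level1_disjoint:
  assumes "E \<in> Fr" "arrow E i c" "v \<in> V" "depth E v = 2" "crd E i v = -1"
    and "w \<in> V" "depth E w = 1" "crd E i w = 0" "l \<in> E" "crd E l w < 0"
  shows "0 \<le> crd E l v" "l = c \<Longrightarrow> 1 \<le> crd E l v"
proof -
  have li: "l \<noteq> i" using assms by auto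
  have "depth (flip E i) v = 1" and v: "crd (flip E i) l v = crd E l v + (if l = c then -1 else 0)"
    using arrow_flip[OF assms(1,2) V_N[OF assms(3)]] assms li by auto
  moreover have "depth (flip E i) w = 1" "crd (flip E i) l w = crd E l w"
    using arrow_flip[OF assms(1,2) V_N[OF assms(6)]] assms li by auto
  moreover have fr: "flip E i \<in> Fr" "l \<in> flip E i"
    using neighbour(3)[OF assms(1)] arrow_in[OF assms(2)] assms li by auto
  moreover have "v \<noteq> w" using assms by auto
  ultimately have "\<not> crd (flip E i) l v < 0"
    using level0_neg(2)[OF fr(1) _ _ fr(2)] assms by metis
  then show "0 \<le> crd E l v" "l = c \<Longrightarrow> 1 \<le> crd E l v" using v by (auto split: if_splits)
qed

text \<open>The arrow leaving \<open>l\<close> is negative at \<open>l\<close>, so by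
  \<open>level1_disjoint\<close> it cannot vanish at \<open>i\<close>; thus \<open>i\<close> is its
  head. By symmetry the arrow leaving \<open>i\<close> has head \<open>l\<close>, and
  \<open>level1_head_nonneg\<close> is violated.\<close>

lemma level1_tail_unique:
  assumes "E \<in> Fr" "v \<in> V" "depth E v = 2"
    and "arrow E i c" "arrow E l c'" "crd E i v < 0" "crd E l v < 0"
  shows "i = l"
proof (rule ccontr)
  assume ne: "i \<noteq> l"
  have m: "crd E i v = -1" "crd E l v = -1"
    using level1_neg(1)[OF assms(1-3)] assms arrow_in by blast+
  have *: "c' = i" if "arrow E i c" "arrow E l c'" "i \<noteq> l" "crd E i v = -1" "crd E l v = -1" for i l c c'
  proof (rule ccontr)
    assume "c' \<noteq> i"
    then have "crd E i (c' - l) = 0" "crd E l (c' - l) = -1"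
      using crd_difference[OF assms(1)] that arrow_in(1,2)[OF that(1)] arrow_in(1-3)[OF that(2)] by auto
    then show False
      using level1_disjoint(1)[OF assms(1) that(1) assms(2,3) that(4), of "c' - l" l] arrowD[OF assms(1) that(2)]
        arrow_in[OF that(2)] that by auto
  qed
  have "c' = i" "c = l" using *[OF assms(4,5) ne m] *[OF assms(5,4) ne[symmetric] m(2,1)] by auto
  then show False using level1_head_nonneg[OF assms(1,4,2,3) m(1)] m by simp
qed

text \<open>Apply \<open>level1_disjoint\<close> to \<open>- i\<close>, of depth 2, and the arrow
  leaving \<open>c\<close>: if that arrow vanished at \<open>i\<close>, the vertex
  \<open>- i\<close> would have to be positive at \<open>c\<close>.\<close>

lemma arrow_involutive:
  assumes "E \<in> Fr" "arrow E i c" "arrow E c c'" "- i \<in> V"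
  shows "c' = i"
proof (rule ccontr)
  assume ne: "c' \<noteq> i"
  note a = arrow_in[OF assms(2)] and b = arrow_in[OF assms(3)]
  have s: "(\<Sum>j\<in>E. crd E j (- i)) = (\<Sum>j\<in>E. if j = i then -1 else 0)"
    by (rule sum.cong[OF refl]) (use crd_neg_frame[OF assms(1) a(1)] in auto)
  have "depth E (- i) = 2" "crd E i (- i) = -1" "crd E c (- i) = 0"
    using s crd_neg_frame[OF assms(1) a(1)] a finite_frame[OF assms(1)] by (auto simp: depth_def)
  moreover have "crd E i (c' - c) = 0" "crd E c (c' - c) = -1"
    using crd_difference[OF assms(1) b(1,2)] a b ne by auto
  ultimately show False
    using level1_disjoint(2)[OF assms(1,2,4) _ _ b(4) arrowD(1)[OF assms(1,3)], of c] a by auto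
qed

text \<open>
  Induction by pivoting: some \<open>l\<close> in \<open>S\<close> carries at least as much weight as all its predecessors
  under \<open>\<phi>\<close> in \<open>S\<close>.  Flipping \<open>l\<close> destroys only the arrows of these predecessors and lowers the
  depth of \<open>v\<close> by the weight of \<open>l\<close>.
\<close>

lemma sum_tails_le:
  assumes "E \<in> Fr" "v \<in> V" "finite S" "\<And>e. e \<in> S \<Longrightarrow> arrow E e (\<phi> e)" "\<And>e. e \<in> S \<Longrightarrow> crd E e v < 0"
  shows "(\<Sum>e\<in>S. - crd E e v) \<le> 2 * depth E v"
  using assms
proof (induction "card S" arbitrary: S E rule: less_induct)
  case less
  note E = less.prems(1) and v = less.prems(2) and fin = less.prems(3) and arr = less.prems(4) and neg = less.prems(5)
  show ?case
  proof (cases "S = {}")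
    case True
    then show ?thesis using depth_nonneg[OF E v] by simp
  next
    case False
    \<comment> \<open>Each \<open>p\<close> is a predecessor of the single index
      \<open>\<phi> p\<close>, so the predecessor weights add up to at most the weight of
      \<open>S\<close> and cannot exceed the own weight at every \<open>l\<close>.\<close>
    obtain l where l: "l \<in> S" "(\<Sum>p | p \<in> S \<and> \<phi> p = l. - crd E p v) \<le> - crd E l v"
    proof (rule ccontr)
      assume "\<not> thesis"
      then have "\<And>l. l \<in> S \<Longrightarrow> - crd E l v < (\<Sum>p | p \<in> S \<and> \<phi> p = l. - crd E p v)"
        using that by force
      then have "(\<Sum>l\<in>S. - crd E l v) < (\<Sum>l\<in>S. \<Sum>p | p \<in> S \<and> \<phi> p = l. - crd E p v)"
        using fin False by (intro sum_strict_mono) auto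
      also have "\<dots> = (\<Sum>l\<in>S. \<Sum>p | p \<in> {p \<in> S. \<phi> p \<in> S} \<and> \<phi> p = l. - crd E p v)"
        by (intro sum.cong) auto
      also have "\<dots> = (\<Sum>p | p \<in> S \<and> \<phi> p \<in> S. - crd E p v)"
        using fin by (subst sum.group) auto
      also have "\<dots> \<le> (\<Sum>p\<in>S. - crd E p v)"
        using fin neg by (intro sum_mono2) (auto simp: less_imp_le)
      finally show False by simp
    qed
    define P where "P = {p \<in> S. \<phi> p = l}"
    define S' where "S' = S - insert l P"
    have lP: "l \<notin> P" using arr l arrow_in(3) by (auto simp: P_def)
    have PS: "P \<subseteq> S" by (auto simp: P_def)
    have lE: "l \<in> E" using arr[OF l(1)] arrow_in by blast
    have F: "flip E l \<in> Fr" using neighbour(3)[OF E lE] .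
    have S'E: "e \<in> E" "e \<noteq> l" if "e \<in> S'" for e using that arr arrow_in by (auto simp: S'_def)
    note fl = arrow_flip[OF E arr[OF l(1)] V_N[OF v]]
    \<comment> \<open>Among the surviving indices only \<open>\<phi> l\<close> can change its
      coordinate, and that one drops, so no surviving weight shrinks.\<close>
    have crd': "crd (flip E l) e v \<le> crd E e v" if "e \<in> S'" for e
      using fl(2)[of e] S'E[OF that] neg[OF l(1)] by auto
    have "(\<Sum>e\<in>S'. - crd (flip E l) e v) \<le> 2 * depth (flip E l) v"
    proof (rule less.hyps[OF _ F v])
      show "card S' < card S" using fin l by (intro psubset_card_mono) (auto simp: S'_def)
      show "finite S'" using fin by (simp add: S'_def)
      show "arrow (flip E l) e (\<phi> e)" if "e \<in> S'" for e
        using that arr[of e] by (auto simp: arrow_def S'_def P_def)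
      show "crd (flip E l) e v < 0" if "e \<in> S'" for e
        using crd'[OF that] neg[of e] that by (auto simp: S'_def)
    qed
    moreover have "(\<Sum>e\<in>S'. - crd E e v) \<le> (\<Sum>e\<in>S'. - crd (flip E l) e v)"
      using crd' by (intro sum_mono) auto
    \<comment> \<open>The discarded set \<open>insert l P\<close> weighs at most twice as much as
      \<open>l\<close>, and the depth drops by the weight of \<open>l\<close>: this is the factor 2
      in the bound.\<close>
    moreover have "(\<Sum>e\<in>S. - crd E e v) = (\<Sum>e\<in>S'. - crd E e v) + (- crd E l v + (\<Sum>e\<in>P. - crd E e v))"
    proof -
      have "(\<Sum>e\<in>S. - crd E e v) = (\<Sum>e\<in>S'. - crd E e v) + (\<Sum>e\<in>insert l P. - crd E e v)"
        unfolding S'_def using fin PS l by (intro sum.subset_diff) auto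
      then show ?thesis using lP fin PS by (simp add: finite_subset)
    qed
    ultimately show ?thesis using fl(1) l(2) by (simp add: P_def)
  qed
qed

end

subsection \<open>Counting vertices by depth\<close>

text \<open>The hypothesis \<open>special\<close> says that the sum of all vertices lies in the cone over the facet.\<close>

locale special_frame = fano_frames +
  fixes E :: "'a set" and k :: int
  assumes E: "E \<in> Fr"
    and zero_notin: "0 \<notin> V"
    and special: "e \<in> E \<Longrightarrow> 0 \<le> (\<Sum>v\<in>V. crd E e v)"
    and card_V: "int (card V) = 3 * int (card E) - k"
begin

definition "level0 = {v \<in> V. depth E v = 1}"
definition "level1 = {v \<in> V. depth E v = 2}"
definition "lower = {v \<in> V. 3 \<le> depth E v}"
definition "tails = {e \<in> E. \<exists>c. arrow E e c}"
definition "head e = (SOME c. arrow E e c)"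
definition "nontails = E - tails"
definition "irregular0 = level0 - (\<lambda>e. head e - e) ` tails"
text \<open>Every vertex of \<open>lower\<close> contributes at least 1 and at least a third of its
  depth, so this one number controls both how many there are and their total depth.\<close>

definition "defect = (\<Sum>v\<in>lower. depth E v - 2)"
definition "colsum e = (\<Sum>v\<in>V. crd E e v)"

lemma finites: "finite level0" "finite level1" "finite lower" "finite tails" "finite nontails" "finite irregular0" "finite E"
  using finite_V finite_frame[OF E] by (auto simp: level0_def level1_def lower_def tails_def nontails_def irregular0_def)

lemma subsets: "level0 \<subseteq> V" "level1 \<subseteq> V" "lower \<subseteq> V" "tails \<subseteq> E" "nontails \<subseteq> E" "irregular0 \<subseteq> level0" "E \<subseteq> V"
  using frame_subset[OF E] by (auto simp: level0_def level1_def lower_def tails_def nontails_def irregular0_def)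

lemma level_cases:
  assumes "v \<in> V"
  obtains "v \<in> E" | "v \<in> level0" | "v \<in> level1" | "v \<in> lower"
  using assms depth_pos[OF E assms] by (cases "v \<in> E") (force simp: level0_def level1_def lower_def)+

lemma arrow_phi: "e \<in> tails \<Longrightarrow> arrow E e (head e)"
  unfolding tails_def head_def by (auto intro: someI_ex)

lemma arrow_iff: "arrow E e c \<longleftrightarrow> e \<in> tails \<and> c = head e"
proof
  assume a: "arrow E e c"
  then have "e \<in> tails" using arrow_in(1) by (auto simp: tails_def)
  then show "e \<in> tails \<and> c = head e" using arrow_phi arrow_unique[OF E a] by blast
qed (use arrow_phi in blast)

lemma arrow_level0: "e \<in> tails \<Longrightarrow> head e - e \<in> level0"
  using arrowD(1)[OF E arrow_phi] arrow_in(4)[OF arrow_phi] by (auto simp: level0_def)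

lemma inj_arrow: "inj_on (\<lambda>e. head e - e) tails"
proof (rule inj_onI)
  fix x y assume a: "x \<in> tails" "y \<in> tails" "head x - x = head y - y"
  have "crd E x (head x - x) = -1"
    using crd_difference[OF E] arrow_in[OF arrow_phi[OF a(1)]] by auto
  moreover have "crd E x (head y - y) = (if x = head y then 1 else 0) - (if x = y then 1 else 0)"
    using crd_difference[OF E] arrow_in[OF arrow_phi[OF a(2)]] arrow_in[OF arrow_phi[OF a(1)]] by auto
  ultimately show "x = y" using a by (auto split: if_splits)
qed

section \<open>Negative supports and the number of vertices of depth 1\<close>

definition neg :: "'a set \<Rightarrow> 'a \<Rightarrow> 'a set" where "neg F v = {e \<in> F. crd F e v < 0}"

lemma sum_crd_eq: "(\<Sum>e\<in>F. crd F e v) = 1 - depth F v"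
  by (simp add: depth_def)

text \<open>Positive coordinates are at least 1, and all coordinates together add up to
  \<open>1 - depth F v\<close>.\<close>

lemma card_pos_le:
  assumes "finite F"
  shows "int (card {e \<in> F. 0 < crd F e v}) \<le> (\<Sum>e\<in>neg F v. - crd F e v) + (1 - depth F v)"
proof -
  have "1 - depth F v = (\<Sum>e\<in>F. crd F e v)" by (simp add: depth_def)
  also have "\<dots> = (\<Sum>e\<in>neg F v. crd F e v) + (\<Sum>e\<in>F - neg F v. crd F e v)"
    using assms by (subst sum.subset_diff[of "neg F v"]) (auto simp: neg_def)
  also have "(\<Sum>e\<in>F - neg F v. crd F e v) = (\<Sum>e | e \<in> F \<and> 0 < crd F e v. crd F e v)"
    using assms by (intro sum.mono_neutral_right) (auto simp: neg_def)
  moreover have "int (card {e \<in> F. 0 < crd F e v}) = (\<Sum>e | e \<in> F \<and> 0 < crd F e v. 1)" by simp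
  moreover have "\<dots> \<le> (\<Sum>e | e \<in> F \<and> 0 < crd F e v. crd F e v)"
    by (intro sum_mono) auto
  ultimately show ?thesis by (simp add: sum_negf)
qed

text \<open>The coordinate sum is 0, so without a negative coordinate all coordinates would vanish,
  and 0 is not a vertex.\<close>

lemma level0_sum_neg:
  assumes "F \<in> Fr" "v \<in> V" "depth F v = 1"
  shows "(\<Sum>e\<in>neg F v. - crd F e v) = int (card (neg F v))" "neg F v \<noteq> {}"
proof -
  have fin: "finite F" using finite_frame assms by auto
  have "- crd F e v = 1" if "e \<in> neg F v" for e
    using level0_neg(1)[OF assms] that by (auto simp: neg_def)
  then show eq: "(\<Sum>e\<in>neg F v. - crd F e v) = int (card (neg F v))" by simp
  show "neg F v \<noteq> {}"
  proof
    assume e: "neg F v = {}"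
    then have "{e \<in> F. 0 < crd F e v} = {}"
      using card_pos_le[OF fin, of v] assms(3) fin by simp
    with e have "crd F e v = 0" if "e \<in> F" for e
      using that by (force simp: neg_def)
    then have "v = 0"
      using lattice_basis_crd[OF frame_basis[OF assms(1)] V_N[OF assms(2)]] by simp
    then show False using zero_notin assms by simp
  qed
qed

text \<open>The frame \<open>F\<close> is arbitrary because \<open>level1_bad_counts\<close> needs
  this in an adjacent facet. The negative supports are disjoint and nonempty, and at depth 1 there
  are at most as many positive as negative coordinates.\<close>

lemma level0_count:
  assumes "F \<in> Fr" "R \<subseteq> V" "\<And>v. v \<in> R \<Longrightarrow> depth F v = 1" "finite X" "\<And>v. v \<in> R \<Longrightarrow> neg F v \<subseteq> X"
  shows "(\<Sum>v\<in>R. card (neg F v)) \<le> card X"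
    and "card R \<le> card X"
    and "card {e \<in> F. \<exists>v\<in>R. 0 < crd F e v} \<le> card X"
proof -
  have fin: "finite F" "finite R" using finite_frame assms finite_V finite_subset by auto
  have "(\<Sum>v\<in>R. card (neg F v)) = card (\<Union>v\<in>R. neg F v)"
  proof (rule card_UN_disjoint[symmetric])
    show "\<forall>v\<in>R. finite (neg F v)" using fin by (auto simp: neg_def)
    show "\<forall>v\<in>R. \<forall>w\<in>R. v \<noteq> w \<longrightarrow> neg F v \<inter> neg F w = {}"
    proof (intro ballI impI equals0I)
      fix v w e assume a: "v \<in> R" "w \<in> R" "v \<noteq> w" "e \<in> neg F v \<inter> neg F w"
      then have "v \<in> V" "w \<in> V" "depth F v = 1" "depth F w = 1" "e \<in> F" "crd F e v < 0" "crd F e w < 0"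
        using assms(2,3) by (auto simp: neg_def)
      then have "v = neighbour F e" "w = neighbour F e"
        by (blast intro: level0_neg(2)[OF assms(1)])+
      then show False using a by simp
    qed
  qed (use fin in auto)
  also have "\<dots> \<le> card X" by (rule card_mono[OF assms(4) UN_least[OF assms(5)]])
  finally show 1: "(\<Sum>v\<in>R. card (neg F v)) \<le> card X" .
  have "card R = (\<Sum>v\<in>R. 1)" by simp
  also have "\<dots> \<le> (\<Sum>v\<in>R. card (neg F v))"
  proof (rule sum_mono)
    fix v assume v: "v \<in> R"
    have "finite (neg F v)" using fin by (simp add: neg_def)
    then show "1 \<le> card (neg F v)"
      using level0_sum_neg(2)[OF assms(1), of v] assms(2,3) v by (auto simp: Suc_le_eq card_gt_0_iff)
  qed
  finally show "card R \<le> card X" using 1 by simp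
  have "card {e \<in> F. \<exists>v\<in>R. 0 < crd F e v} = card (\<Union>v\<in>R. {e \<in> F. 0 < crd F e v})"
    by (rule arg_cong[where f = card]) auto
  also have "\<dots> \<le> (\<Sum>v\<in>R. card {e \<in> F. 0 < crd F e v})"
    by (rule card_UN_le[OF fin(2)])
  also have "\<dots> \<le> (\<Sum>v\<in>R. card (neg F v))"
  proof (rule sum_mono)
    fix v assume v: "v \<in> R"
    then have "v \<in> V" "depth F v = 1" using assms by auto
    from card_pos_le[OF fin(1), of v] level0_sum_neg(1)[OF assms(1) this] this
    show "card {e \<in> F. 0 < crd F e v} \<le> card (neg F v)" by simp
  qed
  finally show "card {e \<in> F. \<exists>v\<in>R. 0 < crd F e v} \<le> card X" using 1 by simp
qed

text \<open>At a tail the only vertex of depth 1 with negative coordinate is the arrow. If there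
  were just one negative coordinate, it would be -1, and the sum 0 would leave room for a single
  coordinate 1: an arrow again.\<close>

lemma irregular0_neg:
  assumes "w \<in> irregular0"
  shows "neg E w \<subseteq> nontails" "2 \<le> card (neg E w)"
proof -
  have w: "w \<in> V" "depth E w = 1" using assms by (auto simp: irregular0_def level0_def)
  show sub: "neg E w \<subseteq> nontails"
  proof
    fix e assume e: "e \<in> neg E w"
    then have "w = neighbour E e" using level0_neg(2)[OF E w] by (auto simp: neg_def)
    moreover have "neighbour E e = head e - e" if "e \<in> tails" using arrowD(2)[OF E arrow_phi[OF that]] .
    ultimately show "e \<in> nontails" using assms e by (auto simp: irregular0_def nontails_def neg_def)
  qed
  show "2 \<le> card (neg E w)"
  proof (rule ccontr)
    assume "\<not> 2 \<le> card (neg E w)"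
    moreover have "card (neg E w) \<noteq> 0"
      using level0_sum_neg(2)[OF E w] finites by (auto simp: neg_def)
    ultimately have c1: "card (neg E w) = 1" by linarith
    then obtain e where e: "neg E w = {e}" by (auto simp: card_1_singleton_iff)
    have eE: "e \<in> E" "crd E e w = -1" using e level0_neg(1)[OF E w, of e] by (auto simp: neg_def)
    have nn: "0 \<le> crd E j w" if "j \<in> E" "j \<noteq> e" for j
      using e that by (force simp: neg_def)
    have sum: "(\<Sum>j\<in>E - {e}. crd E j w) = 1"
      using sum_crd_eq[of E w] w(2) eE finites by (simp add: sum.remove[of E e])
    then obtain c where c: "c \<in> E - {e}" "crd E c w \<noteq> 0"
      by (metis sum.neutral zero_neq_one)
    have sum2: "crd E c w + (\<Sum>j\<in>E - {e} - {c}. crd E j w) = 1"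
      using sum c finites by (subst (asm) sum.remove[of _ c]) auto
    have "0 \<le> (\<Sum>j\<in>E - {e} - {c}. crd E j w)" using nn by (intro sum_nonneg) auto
    with sum2 c nn[of c] have cc: "crd E c w = 1" "(\<Sum>j\<in>E - {e} - {c}. crd E j w) = 0"
      by auto
    then have z: "crd E j w = 0" if "j \<in> E - {e} - {c}" for j
      using that nn finites by (subst (asm) sum_nonneg_eq_0_iff) auto
    have "w = (\<Sum>j\<in>E. of_int (crd E j w) *\<^sub>R j)"
      using lattice_basis_crd[OF frame_basis[OF E] V_N[OF w(1)]] .
    also have "\<dots> = - e + (\<Sum>j\<in>E - {e}. of_int (crd E j w) *\<^sub>R j)"
      using eE finites by (subst sum.remove[of E e]) auto
    also have "(\<Sum>j\<in>E - {e}. of_int (crd E j w) *\<^sub>R j) = c"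
      using c cc z finites by (subst sum.remove[of _ c]) auto
    finally have "w = c - e" by simp
    then have "arrow E e c" using c eE w by (auto simp: arrow_def)
    then have "w \<in> (\<lambda>e. head e - e) ` tails" using \<open>w = c - e\<close> by (auto simp: arrow_iff)
    then show False using assms by (simp add: irregular0_def)
  qed
qed

lemma card_levels:
  "int (card V) = int (card E) + int (card level0) + int (card level1) + int (card lower)"
  "(\<Sum>e\<in>E. colsum e) = int (card E) - int (card level1) - (\<Sum>v\<in>lower. depth E v - 1)"
proof -
  have dE: "depth E v = 0" if "v \<in> E" for v using depth_frame[OF E that] .
  have Veq: "V = E \<union> (level0 \<union> (level1 \<union> lower))"
  proof
    show "V \<subseteq> E \<union> (level0 \<union> (level1 \<union> lower))" by (rule subsetI, erule level_cases) simp_all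
  qed (use subsets in simp)
  have dj: "E \<inter> (level0 \<union> (level1 \<union> lower)) = {}"
    using dE by (force simp: level0_def level1_def lower_def)
  have dj2: "level0 \<inter> (level1 \<union> lower) = {}" "level1 \<inter> lower = {}"
    by (auto simp: level0_def level1_def lower_def)
  show "int (card V) = int (card E) + int (card level0) + int (card level1) + int (card lower)"
    using finites dj dj2 by (subst Veq) (simp add: card_Un_disjoint)
  have "(\<Sum>e\<in>E. colsum e) = (\<Sum>v\<in>V. 1 - depth E v)"
    unfolding colsum_def by (subst sum.swap) (simp add: sum_crd_eq)
  also have "\<dots> = (\<Sum>v\<in>E. 1 - depth E v) + ((\<Sum>v\<in>level0. 1 - depth E v) + ((\<Sum>v\<in>level1. 1 - depth E v) + (\<Sum>v\<in>lower. 1 - depth E v)))"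
    using finites dj dj2 by (subst Veq) (simp add: sum.union_disjoint)
  also have "(\<Sum>v\<in>E. 1 - depth E v) = int (card E)" using dE by simp
  also have "(\<Sum>v\<in>level0. 1 - depth E v) = 0" by (simp add: level0_def)
  also have "(\<Sum>v\<in>level1. 1 - depth E v) = - int (card level1)" by (simp add: level1_def)
  also have "(\<Sum>v\<in>lower. 1 - depth E v) = - (\<Sum>v\<in>lower. depth E v - 1)" by (simp flip: sum_negf)
  finally show "(\<Sum>e\<in>E. colsum e) = int (card E) - int (card level1) - (\<Sum>v\<in>lower. depth E v - 1)" by simp
qed

text \<open>
  The three summands are nonnegative: this is the budget that bounds every irregularity by \<open>k\<close>.
\<close>

lemma balance:
  "(\<Sum>e\<in>E. colsum e) + (int (card E) - int (card level0)) + defect = k"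
proof -
  have "(\<Sum>v\<in>lower. depth E v - 1) = defect + int (card lower)"
    by (simp add: defect_def sum_subtractf)
  then show ?thesis using card_levels card_V by linarith
qed

lemma card_lower_le: "int (card lower) \<le> defect"
proof -
  have "int (card lower) = (\<Sum>v\<in>lower. 1)" by simp
  also have "\<dots> \<le> defect" unfolding defect_def by (intro sum_mono) (auto simp: lower_def)
  finally show ?thesis .
qed

lemma card_E: "int (card E) = int (card tails) + int (card nontails)"
proof -
  have "card E = card tails + card (E - tails)"
    using card_Diff_subset[of tails E] card_mono[of E tails] finites subsets by simp
  then show ?thesis by (simp add: nontails_def)
qed

lemma sum_sigma_nonneg: "0 \<le> (\<Sum>e\<in>E. colsum e)"
  unfolding colsum_def by (rule sum_nonneg, rule special)

text \<open>Every vertex of \<open>irregular0\<close> occupies at least two nontails of its own, so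
  with b nontails there are at most \<open>d - b / 2\<close> vertices of depth 1. Hence b is at most
  twice the shortage \<open>d - card level0\<close>, which \<open>balance\<close> evaluates.\<close>

lemma card_nontails_le:
  "int (card nontails) \<le> 2 * (k - defect - (\<Sum>e\<in>E. colsum e))"
  "int (card level0) \<le> int (card E)"
proof -
  have "2 * card irregular0 = (\<Sum>w\<in>irregular0. 2)" by simp
  also have "\<dots> \<le> (\<Sum>w\<in>irregular0. card (neg E w))" using irregular0_neg(2) by (intro sum_mono) auto
  also have "\<dots> \<le> card nontails"
    by (rule level0_count(1)[OF E _ _ finites(5) irregular0_neg(1)]) (auto simp: irregular0_def level0_def)
  finally have 1: "2 * card irregular0 \<le> card nontails" .
  have "level0 = (\<lambda>e. head e - e) ` tails \<union> irregular0" using arrow_level0 by (auto simp: irregular0_def)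
  then have "card level0 \<le> card tails + card irregular0"
    using card_Un_le[of "(\<lambda>e. head e - e) ` tails" irregular0] card_image[OF inj_arrow] by simp
  then have "int (card level0) \<le> int (card tails) + int (card irregular0)" "2 * int (card irregular0) \<le> int (card nontails)"
    using 1 by linarith+
  note * = this card_E
  from * have "int (card nontails) \<le> 2 * (int (card E) - int (card level0))" by presburger
  also have "\<dots> = 2 * (k - defect - (\<Sum>e\<in>E. colsum e))" using balance by simp
  finally show "int (card nontails) \<le> 2 * (k - defect - (\<Sum>e\<in>E. colsum e))" .
  from * show "int (card level0) \<le> int (card E)" by linarith
qed

lemma card_level1_ge: "int (card E) - k - defect \<le> int (card level1)"
  using card_levels(1) card_V card_lower_le card_nontails_le(2) by linarith

section \<open>Vertices of depth 2 and the exceptional ones among them\<close>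

lemma level1_V: "v \<in> level1 \<Longrightarrow> v \<in> V" "v \<in> level1 \<Longrightarrow> depth E v = 2"
  by (auto simp: level1_def)

lemma level1_crd_neg: "v \<in> level1 \<Longrightarrow> e \<in> E \<Longrightarrow> crd E e v < 0 \<Longrightarrow> crd E e v = -1"
  using level1_neg(1)[OF E level1_V] .

lemma neighbour_tails: "e \<in> tails \<Longrightarrow> neighbour E e = head e - e"
  using arrowD(2)[OF E arrow_phi] .

lemma level0_neg_tails:
  assumes "v \<in> level0" "e \<in> tails" "crd E e v < 0"
  shows "v = head e - e"
  using level0_neg(2)[OF E, of v e] neighbour_tails assms subsets by (auto simp: level0_def)

definition "irregular1 = {v \<in> level1. \<exists>c\<in>nontails. crd E c v < 0}"

lemma level1_tails_unique:
  assumes "v \<in> level1" "e \<in> tails" "e' \<in> tails" "crd E e v < 0" "crd E e' v < 0"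
  shows "e = e'"
  using level1_tail_unique[OF E level1_V[OF assms(1)] arrow_phi[OF assms(2)] arrow_phi[OF assms(3)] assms(4,5)] .

text \<open>All negative coordinates sit at tails, where only one is possible, equal to -1. Since
  the coordinates sum to -1, nothing positive remains.\<close>

lemma level1_regular:
  assumes "v \<in> level1" "v \<notin> irregular1"
  shows "\<exists>e\<in>tails. v = - e"
proof -
  have nG: "neg E v \<subseteq> tails" using assms by (auto simp: neg_def irregular1_def nontails_def)
  have "neg E v \<noteq> {}"
  proof
    assume "neg E v = {}"
    then have "0 \<le> (\<Sum>e\<in>E. crd E e v)" by (intro sum_nonneg) (force simp: neg_def)
    then show False using sum_crd_eq[of E v] level1_V[OF assms(1)] by simp
  qed
  then obtain e where e: "e \<in> neg E v" by blast
  have eG: "e \<in> tails" "e \<in> E" "crd E e v < 0" using e nG by (auto simp: neg_def)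
  have m1: "crd E e v = -1" using level1_crd_neg[OF assms(1) eG(2,3)] .
  have nn: "0 \<le> crd E j v" if "j \<in> E - {e}" for j
  proof (rule ccontr)
    assume "\<not> 0 \<le> crd E j v"
    then have "j \<in> neg E v" using that by (simp add: neg_def)
    then have "j = e" using level1_tails_unique[OF assms(1), of j e] nG eG by (auto simp: neg_def)
    then show False using that by simp
  qed
  have "(\<Sum>j\<in>E - {e}. crd E j v) = 0"
    using sum_crd_eq[of E v] level1_V[OF assms(1)] m1 eG finites by (simp add: sum.remove[of E e])
  then have z: "crd E j v = 0" if "j \<in> E - {e}" for j
    using that nn finites by (subst (asm) sum_nonneg_eq_0_iff) auto
  have "v = (\<Sum>j\<in>E. of_int (crd E j v) *\<^sub>R j)"
    using lattice_basis_crd[OF frame_basis[OF E] V_N[OF level1_V(1)[OF assms(1)]]] .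
  also have "\<dots> = - e"
    using eG finites m1 z by (subst sum.remove[of E e]) auto
  finally show ?thesis using eG by blast
qed

lemma neighbour_irregular:
  assumes c: "c \<in> nontails" and d: "depth E (neighbour E c) = 1"
  shows "neighbour E c \<in> irregular0"
proof (rule ccontr)
  have cE: "c \<in> E" using c subsets by auto
  have "neighbour E c \<in> level0" using neighbour(1)[OF E cE] d by (simp add: level0_def)
  moreover assume "neighbour E c \<notin> irregular0"
  ultimately obtain e where e: "e \<in> tails" "neighbour E c = head e - e" by (auto simp: irregular0_def)
  have "crd E c (neighbour E c) = (if c = head e then 1 else 0) - (if c = e then 1 else 0)"
    using crd_difference[OF E _ _ cE] arrow_in[OF arrow_phi[OF e(1)]] e(2) by metis
  then have "c = e" using crd_neighbour[OF E cE] by (auto split: if_splits)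
  then show False using e c by (simp add: nontails_def)
qed

text \<open>Let \<open>w\<close> be the neighbour at \<open>c\<close>. If \<open>v\<close> differs
  from \<open>w\<close>, then \<open>w\<close> has depth 1 and both are negative at
  \<open>c\<close>; if \<open>w\<close> vanished at the tail \<open>l\<close>, the flip at
  \<open>l\<close> would contradict disjointness. A negative coordinate at \<open>l\<close> would
  make \<open>w\<close> an arrow.\<close>

lemma level1_exceptional:
  assumes v: "v \<in> level1" and l: "l \<in> tails" "crd E l v < 0" and c: "c \<in> nontails" "crd E c v < 0"
  shows "v = neighbour E c \<or> neighbour E c \<in> irregular0 \<and> 0 < crd E l (neighbour E c)"
proof (cases "v = neighbour E c")
  case False
  have cE: "c \<in> E" using c subsets by auto
  define w where "w = neighbour E c"
  have wV: "w \<in> V" using neighbour(1)[OF E cE] w_def by simp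
  have dw: "depth E w = 1"
    using level1_neg(2)[OF E level1_V[OF v] cE c(2)] False w_def by simp
  have cw: "crd E c w = -1" using crd_neighbour[OF E cE] w_def by simp
  have w0: "w \<in> level0" using wV dw by (simp add: level0_def)
  have wb: "w \<in> irregular0" using neighbour_irregular[OF c(1)] dw by (simp add: w_def)
  have "0 < crd E l w"
  proof (rule ccontr)
    assume "\<not> 0 < crd E l w"
    moreover have "\<not> crd E l w < 0"
    proof
      assume "crd E l w < 0"
      then have "w = head l - l" by (rule level0_neg_tails[OF w0 l(1)])
      then show False using wb l(1) by (auto simp: irregular0_def)
    qed
    ultimately have lw: "crd E l w = 0" by simp
    have "crd E l v = -1" using level1_crd_neg[OF v _ l(2)] l(1) subsets by auto
    from level1_disjoint(1)[OF E arrow_phi[OF l(1)] level1_V[OF v] this wV dw lw cE] cw c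
    show False by simp
  qed
  then show ?thesis using wb w_def by simp
qed simp

text \<open>At most one negative coordinate lies outside the nontails, and the coordinate sum -1
  compensates for it.\<close>

lemma card_pos_level1:
  assumes "v \<in> level1"
  shows "card {e \<in> E. 0 < crd E e v} \<le> card nontails"
proof -
  have fn: "finite (neg E v \<inter> tails)" using finites by simp
  have m1: "- crd E e v = 1" if "e \<in> neg E v" for e
    using level1_crd_neg[OF assms] that by (simp add: neg_def)
  have "card (neg E v \<inter> tails) \<le> 1"
    unfolding card_le_Suc0_iff_eq[OF fn, folded One_nat_def] using level1_tails_unique[OF assms] by (auto simp: neg_def)
  moreover have "neg E v \<subseteq> nontails \<union> (neg E v \<inter> tails)" by (auto simp: neg_def nontails_def)
  then have "card (neg E v) \<le> card (nontails \<union> (neg E v \<inter> tails))" using finites by (intro card_mono) auto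
  then have "card (neg E v) \<le> card nontails + card (neg E v \<inter> tails)" using card_Un_le order_trans by blast
  ultimately have "card (neg E v) \<le> card nontails + 1" by simp
  moreover have "(\<Sum>e\<in>neg E v. - crd E e v) = int (card (neg E v))" using m1 by simp
  ultimately show ?thesis
    using card_pos_le[OF finites(7), of v] level1_V[OF assms] by simp
qed

text \<open>
  If the neighbour at \<open>c\<close> has depth 1, then in the adjacent facet the vertices of \<open>R\<close> have depth 1,
  hence pairwise disjoint negative supports, and these avoid almost all tails.
\<close>

lemma level1_bad_counts:
  assumes c: "c \<in> nontails"
  defines "R \<equiv> {v \<in> level1. crd E c v < 0}"
  shows "card R \<le> card nontails"
    and "card {l \<in> E. (\<exists>v\<in>R. 0 < crd E l v) \<and> (\<forall>w\<in>irregular0. crd E l w \<le> 0)} \<le> card nontails"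
proof -
  have cE: "c \<in> E" using c subsets by auto
  define w where "w = neighbour E c"
  have "card R \<le> card nontails \<and> card {l \<in> E. (\<exists>v\<in>R. 0 < crd E l v) \<and> (\<forall>w\<in>irregular0. crd E l w \<le> 0)} \<le> card nontails"
  proof (cases "depth E w = 1")
    case False
    \<comment> \<open>If the neighbour at \<open>c\<close> is deeper, \<open>level1_neg\<close>
      leaves it as the only vertex of depth 2 that can be negative at \<open>c\<close>.\<close>
    have sub: "R \<subseteq> {w}"
      using level1_neg(2)[OF E _ _ cE] False by (auto simp: R_def w_def level1_def)
    have "1 \<le> card nontails" using c finites by (auto simp: Suc_le_eq card_gt_0_iff)
    moreover have "card R \<le> card {w}" using sub by (intro card_mono) auto
    moreover have "card {l \<in> E. (\<exists>v\<in>R. 0 < crd E l v) \<and> (\<forall>w\<in>irregular0. crd E l w \<le> 0)} \<le> card nontails"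
    proof (cases "R = {}")
      case False
      then have w: "w \<in> level1" "R = {w}" using sub by (auto simp: R_def)
      have "card {l \<in> E. (\<exists>v\<in>R. 0 < crd E l v) \<and> (\<forall>w\<in>irregular0. crd E l w \<le> 0)} \<le> card {e \<in> E. 0 < crd E e w}"
        using w finites by (intro card_mono) auto
      then show ?thesis using card_pos_level1[OF w(1)] by simp
    qed simp
    ultimately show ?thesis by simp
  next
    case True
    have wV: "w \<in> V" using neighbour(1)[OF E cE] w_def by simp
    have Fr': "flip E c \<in> Fr" using neighbour(3)[OF E cE] .
    have wb: "w \<in> irregular0" using neighbour_irregular[OF c] True by (simp add: w_def)
    \<comment> \<open>After the flip, coordinate \<open>j\<close> of \<open>v\<close> is
      \<open>crd E j v - crd E j w\<close>. It is negative only where \<open>w\<close> is positive,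
      or where \<open>w\<close> vanishes and \<open>v\<close> is -1; by
      \<open>level1_exceptional\<close> the second case needs a nontail. Since \<open>w\<close> has
      no more positive than negative coordinates, \<open>X\<close> is no larger than
      \<open>nontails\<close>.\<close>
    define X where "X = (nontails - neg E w) \<union> {j \<in> E. 0 < crd E j w}"
    have finX: "finite X" using finites by (simp add: X_def)
    have cX: "card X \<le> card nontails"
    proof -
      have "card {j \<in> E. 0 < crd E j w} \<le> card (neg E w)"
        using card_pos_le[OF finites(7), of w] level0_sum_neg(1)[OF E wV True] True by simp
      moreover have "card (nontails - neg E w) = card nontails - card (neg E w)" "card (neg E w) \<le> card nontails"
        using irregular0_neg(1)[OF wb] finites by (auto simp: card_Diff_subset finite_subset intro: card_mono)
      moreover have "card X \<le> card (nontails - neg E w) + card {j \<in> E. 0 < crd E j w}"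
        unfolding X_def by (rule card_Un_le)
      ultimately show ?thesis by simp
    qed
    have Rm: "v \<in> V" "v \<in> level1" "crd E c v = -1" if "v \<in> R" for v
      using that level1_crd_neg[OF _ cE] by (auto simp: R_def level1_def)
    have dR: "depth (flip E c) v = 1" if "v \<in> R" for v
      using depth_flip[OF E cE V_N[OF Rm(1)[OF that]]] True Rm[OF that] by (simp add: w_def level1_def)
    have fl: "crd (flip E c) j v = crd E j v - crd E j w" if "v \<in> R" "j \<in> E" "j \<noteq> c" for v j
      using crd_flip[OF E cE V_N[OF Rm(1)[OF that(1)]] that(2,3)] Rm[OF that(1)] by (simp add: w_def)
    have flw: "crd (flip E c) w v = 1" if "v \<in> R" for v
      using crd_flip_self[OF E cE V_N[OF Rm(1)[OF that]]] Rm[OF that] by (simp add: w_def)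
    have negX: "neg (flip E c) v \<subseteq> X" if v: "v \<in> R" for v
    proof
      fix j assume j: "j \<in> neg (flip E c) v"
      then have jE: "j \<in> E" "j \<noteq> c" using flw[OF v] by (auto simp: neg_def w_def)
      have lt: "crd E j v < crd E j w" using fl[OF v jE] j by (simp add: neg_def)
      show "j \<in> X"
      proof (cases "0 < crd E j w")
        case True
        then show ?thesis using jE by (simp add: X_def)
      next
        case False
        then have vj: "crd E j v < 0" using lt by simp
        then have "crd E j v = -1" using level1_crd_neg[OF Rm(2)[OF v] jE(1)] by simp
        with lt False have wj: "crd E j w = 0" by simp
        have "j \<in> nontails"
        proof (rule ccontr)
          assume "j \<notin> nontails"
          then have "j \<in> tails" using jE by (simp add: nontails_def)
          from level1_exceptional[OF Rm(2)[OF v] this vj c] Rm(3)[OF v] wj True Rm(2)[OF v]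
          show False by (auto simp: w_def level1_def)
        qed
        then show ?thesis using wj by (simp add: X_def neg_def)
      qed
    qed
    have RV: "R \<subseteq> V" using Rm(1) by blast
    note cnt = level0_count[OF Fr' RV dR finX negX]
    \<comment> \<open>As \<open>w\<close> is itself in \<open>irregular0\<close>, the side condition
      makes it nonpositive at \<open>l\<close>; subtracting it then preserves a positive
      coordinate.\<close>
    have "{l \<in> E. (\<exists>v\<in>R. 0 < crd E l v) \<and> (\<forall>w\<in>irregular0. crd E l w \<le> 0)} \<subseteq> {e \<in> flip E c. \<exists>v\<in>R. 0 < crd (flip E c) e v}"
    proof
      fix l assume "l \<in> {l \<in> E. (\<exists>v\<in>R. 0 < crd E l v) \<and> (\<forall>w\<in>irregular0. crd E l w \<le> 0)}"
      then obtain v where l: "l \<in> E" "v \<in> R" "0 < crd E l v" "crd E l w \<le> 0" using wb by blast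
      then have "l \<noteq> c" using Rm(3) by force
      then have "0 < crd (flip E c) l v" using fl[OF l(2,1)] l by simp
      then show "l \<in> {e \<in> flip E c. \<exists>v\<in>R. 0 < crd (flip E c) e v}" using l \<open>l \<noteq> c\<close> by blast
    qed
    then have "card {l \<in> E. (\<exists>v\<in>R. 0 < crd E l v) \<and> (\<forall>w\<in>irregular0. crd E l w \<le> 0)} \<le> card {e \<in> flip E c. \<exists>v\<in>R. 0 < crd (flip E c) e v}"
      using finites by (intro card_mono) auto
    then show ?thesis using cnt(2,3) cX by linarith
  qed
  then show "card R \<le> card nontails"
    and "card {l \<in> E. (\<exists>v\<in>R. 0 < crd E l v) \<and> (\<forall>w\<in>irregular0. crd E l w \<le> 0)} \<le> card nontails"
    by auto
qed

lemma card_irregular1: "card irregular1 \<le> card nontails * card nontails"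
proof -
  have "irregular1 = (\<Union>c\<in>nontails. {v \<in> level1. crd E c v < 0})" by (auto simp: irregular1_def)
  then have "card irregular1 \<le> (\<Sum>c\<in>nontails. card {v \<in> level1. crd E c v < 0})"
    using card_UN_le[OF finites(5)] by simp
  also have "\<dots> \<le> (\<Sum>c\<in>nontails. card nontails)" by (intro sum_mono level1_bad_counts)
  finally show ?thesis by simp
qed

text \<open>
  The digits refer to the value of \<open>- u\<close>: 0, 1, or 2 for at least 2; so \<open>level0\<close> is depth 1, not 0.
  Raised and lowered are the coordinates in which an exceptional vertex of that level is positive or negative.
\<close>

definition "raised0 = {l \<in> E. \<exists>w\<in>irregular0. 0 < crd E l w}"
definition "lowered1 = {l \<in> tails. \<exists>v\<in>irregular1. crd E l v < 0}"
definition "raised1 = {l \<in> E. (\<exists>v\<in>irregular1. 0 < crd E l v) \<and> l \<notin> raised0}"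
definition "lowered2 = {l \<in> tails. \<exists>v\<in>lower. crd E l v < 0}"
definition "raised2 = {l \<in> E. \<exists>v\<in>lower. 0 < crd E l v}"
definition "negated = {l \<in> tails. - l \<in> V}"

text \<open>Leaving out \<open>raised0\<close> is exactly the side condition of the second count in
  \<open>level1_bad_counts\<close>, which is then summed over the nontails.\<close>

lemma card_raised1: "card raised1 \<le> card nontails * card nontails"
proof -
  have "raised1 = (\<Union>c\<in>nontails. {l \<in> E. (\<exists>v\<in>{v \<in> level1. crd E c v < 0}. 0 < crd E l v) \<and> (\<forall>w\<in>irregular0. crd E l w \<le> 0)})"
    by (fastforce simp: raised1_def raised0_def irregular1_def not_less)
  then have "card raised1 \<le> (\<Sum>c\<in>nontails. card {l \<in> E. (\<exists>v\<in>{v \<in> level1. crd E c v < 0}. 0 < crd E l v) \<and> (\<forall>w\<in>irregular0. crd E l w \<le> 0)})"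
    using card_UN_le[OF finites(5)] by simp
  also have "\<dots> \<le> (\<Sum>c\<in>nontails. card nontails)" by (intro sum_mono level1_bad_counts(2))
  finally show ?thesis by simp
qed

text \<open>Both sets share one budget. Nontails whose neighbour is not in \<open>level1\<close> pay
  for \<open>raised0\<close>. By \<open>level1_exceptional\<close>, any further lowered tail is a
  negative tail of the neighbour at some \<open>c\<close> in \<open>B1\<close>, and each such
  neighbour has at most one.\<close>

lemma card_raised0_lowered1: "card (raised0 \<union> lowered1) \<le> card nontails"
proof -
  define B1 where "B1 = {c \<in> nontails. neighbour E c \<in> level1}"
  have fB1: "finite B1" "B1 \<subseteq> nontails" using finites by (auto simp: B1_def)
  have "card raised0 \<le> card (nontails - B1)"
    unfolding raised0_def
  proof (rule level0_count(3)[OF E])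
    show "irregular0 \<subseteq> V" using subsets by blast
    show "depth E v = 1" if "v \<in> irregular0" for v using that by (simp add: irregular0_def level0_def)
    show "finite (nontails - B1)" using finites by simp
    show "neg E v \<subseteq> nontails - B1" if "v \<in> irregular0" for v
    proof
      fix c assume c: "c \<in> neg E v"
      have v: "v \<in> V" "depth E v = 1" using that by (auto simp: irregular0_def level0_def)
      have "v = neighbour E c" using level0_neg(2)[OF E v] c by (simp add: neg_def)
      with v have "neighbour E c \<notin> level1" by (auto simp: level1_def)
      then show "c \<in> nontails - B1" using irregular0_neg(1)[OF that] c by (auto simp: B1_def)
    qed
  qed
  moreover have "lowered1 \<subseteq> raised0 \<union> (\<Union>c\<in>B1. {l \<in> tails. crd E l (neighbour E c) < 0})"
  proof
    fix l assume "l \<in> lowered1"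
    then obtain v c where l: "l \<in> tails" "v \<in> level1" "crd E l v < 0" "c \<in> nontails" "crd E c v < 0"
      by (auto simp: lowered1_def irregular1_def)
    from level1_exceptional[OF l(2,1,3,4,5)] l subsets
    show "l \<in> raised0 \<union> (\<Union>c\<in>B1. {l \<in> tails. crd E l (neighbour E c) < 0})"
      by (auto simp: raised0_def B1_def)
  qed
  moreover have "card (\<Union>c\<in>B1. {l \<in> tails. crd E l (neighbour E c) < 0}) \<le> card B1"
  proof -
    have "card {l \<in> tails. crd E l (neighbour E c) < 0} \<le> 1" if "c \<in> B1" for c
    proof -
      have f: "finite {l \<in> tails. crd E l (neighbour E c) < 0}" using finites by simp
      show ?thesis
        unfolding card_le_Suc0_iff_eq[OF f, folded One_nat_def]
        using level1_tails_unique[of "neighbour E c"] that by (auto simp: B1_def)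
    qed
    then have "(\<Sum>c\<in>B1. card {l \<in> tails. crd E l (neighbour E c) < 0}) \<le> (\<Sum>c\<in>B1. 1)" by (intro sum_mono)
    then show ?thesis using card_UN_le[OF fB1(1), of "\<lambda>c. {l \<in> tails. crd E l (neighbour E c) < 0}"] by simp
  qed
  moreover have "card nontails = card (nontails - B1) + card B1"
    using fB1 finites card_mono[of nontails B1] by (simp add: card_Diff_subset)
  moreover have "card (raised0 \<union> lowered1) \<le> card (raised0 \<union> (\<Union>c\<in>B1. {l \<in> tails. crd E l (neighbour E c) < 0}))"
    using calculation(2) finites fB1 by (intro card_mono) (auto simp: raised0_def)
  moreover have "card (raised0 \<union> (\<Union>c\<in>B1. {l \<in> tails. crd E l (neighbour E c) < 0})) \<le> card raised0 + card (\<Union>c\<in>B1. {l \<in> tails. crd E l (neighbour E c) < 0})"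
    by (rule card_Un_le)
  ultimately show ?thesis by linarith
qed

section \<open>Vertices of depth at least 3\<close>

lemma sum_depth_lower: "(\<Sum>v\<in>lower. depth E v) \<le> 3 * defect"
  unfolding defect_def sum_distrib_left by (intro sum_mono) (auto simp: lower_def)

lemma sum_neg_tails:
  assumes "v \<in> V"
  shows "(\<Sum>e\<in>neg E v \<inter> tails. - crd E e v) \<le> 2 * depth E v"
  using finites by (intro sum_tails_le[OF E assms, of _ head]) (auto simp: neg_def arrow_phi)

lemma card_lowered2: "int (card lowered2) \<le> 6 * defect"
proof -
  have eq: "lowered2 = (\<Union>v\<in>lower. neg E v \<inter> tails)" using subsets by (auto simp: lowered2_def neg_def)
  have "card lowered2 \<le> (\<Sum>v\<in>lower. card (neg E v \<inter> tails))" unfolding eq by (rule card_UN_le[OF finites(3)])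
  then have "int (card lowered2) \<le> (\<Sum>v\<in>lower. int (card (neg E v \<inter> tails)))" by (simp flip: of_nat_sum)
  also have "\<dots> \<le> (\<Sum>v\<in>lower. 2 * depth E v)"
  proof (rule sum_mono)
    fix v assume "v \<in> lower"
    then have v: "v \<in> V" using subsets by auto
    have "int (card (neg E v \<inter> tails)) = (\<Sum>e\<in>neg E v \<inter> tails. 1)" by simp
    also have "\<dots> \<le> (\<Sum>e\<in>neg E v \<inter> tails. - crd E e v)" by (intro sum_mono) (auto simp: neg_def)
    finally show "int (card (neg E v \<inter> tails)) \<le> 2 * depth E v" using sum_neg_tails[OF v] by linarith
  qed
  also have "\<dots> \<le> 6 * defect" using sum_depth_lower by (simp flip: sum_distrib_left)
  finally show ?thesis .
qed

text \<open>The negative weight of a vertex is at most twice its depth on all tails together and at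
  most its depth at each nontail; \<open>card_pos_le\<close> converts this into a count of positive
  coordinates.\<close>

lemma card_raised2: "int (card raised2) \<le> (int (card nontails) + 2) * (3 * defect)"
proof -
  have "raised2 = (\<Union>v\<in>lower. {e \<in> E. 0 < crd E e v})" by (auto simp: raised2_def)
  then have "card raised2 \<le> (\<Sum>v\<in>lower. card {e \<in> E. 0 < crd E e v})" using card_UN_le[OF finites(3)] by simp
  then have "int (card raised2) \<le> (\<Sum>v\<in>lower. int (card {e \<in> E. 0 < crd E e v}))" by (simp flip: of_nat_sum)
  also have "\<dots> \<le> (\<Sum>v\<in>lower. (int (card nontails) + 2) * depth E v)"
  proof (rule sum_mono)
    fix v assume v2: "v \<in> lower"
    then have v: "v \<in> V" and d: "3 \<le> depth E v" using subsets by (auto simp: lower_def)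
    have "(\<Sum>e\<in>neg E v. - crd E e v) = (\<Sum>e\<in>neg E v \<inter> tails. - crd E e v) + (\<Sum>e\<in>neg E v \<inter> nontails. - crd E e v)"
      using finites by (subst sum.union_disjoint[symmetric]) (auto simp: neg_def nontails_def intro!: sum.cong)
    moreover have "(\<Sum>e\<in>neg E v \<inter> nontails. - crd E e v) \<le> (\<Sum>e\<in>neg E v \<inter> nontails. depth E v)"
    proof (rule sum_mono)
      fix e assume "e \<in> neg E v \<inter> nontails"
      then have "e \<in> E" by (simp add: neg_def)
      from crd_ge_neg_depth[OF E v this] show "- crd E e v \<le> depth E v" by simp
    qed
    moreover have "(\<Sum>e\<in>neg E v \<inter> nontails. depth E v) \<le> int (card nontails) * depth E v"
      using d card_mono[of nontails "neg E v \<inter> nontails"] finites by (auto intro!: mult_right_mono)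
    ultimately have "int (card {e \<in> E. 0 < crd E e v}) \<le> 2 * depth E v + int (card nontails) * depth E v + (1 - depth E v)"
      using card_pos_le[OF finites(7), of v] sum_neg_tails[OF v] by linarith
    then show "int (card {e \<in> E. 0 < crd E e v}) \<le> (int (card nontails) + 2) * depth E v"
      using d by (simp add: algebra_simps)
  qed
  also have "\<dots> \<le> (int (card nontails) + 2) * (3 * defect)"
    using sum_depth_lower by (simp flip: sum_distrib_left)
  finally show ?thesis .
qed

text \<open>With b nontails, at least \<open>d - k - defect - b * b\<close> vertices of depth 2 are
  regular, and each of them is the negative of a tail.\<close>

lemma card_tails_minus_negated: "int (card (tails - negated)) \<le> k + defect - int (card nontails) + int (card nontails) * int (card nontails)"
proof -
  have "level1 \<subseteq> irregular1 \<union> uminus ` negated" using level1_regular level1_V(1) by (fastforce simp: negated_def)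
  then have "card level1 \<le> card (irregular1 \<union> uminus ` negated)"
    using finites by (intro card_mono) (auto simp: irregular1_def negated_def)
  then have "card level1 \<le> card irregular1 + card (uminus ` negated)" using card_Un_le le_trans by blast
  moreover have "card (uminus ` negated) \<le> card negated" using finites by (intro card_image_le) (auto simp: negated_def)
  ultimately have "card level1 \<le> card nontails * card nontails + card negated" using card_irregular1 by linarith
  then have 1: "int (card level1) \<le> int (card nontails) * int (card nontails) + int (card negated)"
    by (metis of_nat_add of_nat_le_iff of_nat_mult)
  have LG: "negated \<subseteq> tails" by (auto simp: negated_def)
  have "card (tails - negated) + card negated = card tails"
    using card_Diff_subset[OF finite_subset[OF LG finites(4)] LG] card_mono[OF finites(4) LG] by simp
  then have "int (card (tails - negated)) + int (card negated) = int (card tails)" by linarith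
  then show ?thesis using 1 card_level1_ge card_E by linarith
qed

section \<open>Columns without exceptional vertices and their pairing\<close>

definition "excess = {l \<in> E. 0 < colsum l}"

lemma sigma_nonneg: "e \<in> E \<Longrightarrow> 0 \<le> colsum e" unfolding colsum_def by (rule special)

lemma card_excess: "int (card excess) \<le> (\<Sum>e\<in>E. colsum e)"
proof -
  have "int (card excess) = (\<Sum>e\<in>excess. 1)" by simp
  also have "\<dots> \<le> (\<Sum>e\<in>excess. colsum e)" by (intro sum_mono) (auto simp: excess_def)
  also have "\<dots> \<le> (\<Sum>e\<in>E. colsum e)"
    using finites sigma_nonneg by (intro sum_mono2) (auto simp: excess_def)
  finally show ?thesis .
qed

text \<open>Dropping raised and lowered indices makes \<open>neg_classification\<close> and
  \<open>pos_classification\<close> list all vertices with nonzero coordinate at \<open>l\<close>.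
  Dropping \<open>excess\<close> makes the column sum 0, the equation used in
  \<open>clean_unique_tail\<close>.\<close>

definition "clean = {l \<in> negated. l \<notin> raised0 \<union> lowered1 \<union> lowered2 \<union> raised1 \<union> raised2 \<union> excess}"

lemma negated_sub: "negated \<subseteq> tails" by (auto simp: negated_def)

lemma phi_in: "l \<in> tails \<Longrightarrow> head l \<in> E" "l \<in> tails \<Longrightarrow> head l \<noteq> l"
  using arrow_in[OF arrow_phi] by auto

lemma neg_classification:
  assumes l: "l \<in> tails" "l \<notin> lowered1" "l \<notin> lowered2" and v: "v \<in> V" "crd E l v < 0"
  shows "v = - l \<or> v = head l - l"
proof -
  have lE: "l \<in> E" using l subsets by auto
  from v(1) show ?thesis
  proof (cases rule: level_cases)
    case 1
    then show ?thesis using crd_frame[OF E 1 lE] v by (auto split: if_splits)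
  next
    case 2
    then show ?thesis using level0_neg_tails[OF 2 l(1) v(2)] by simp
  next
    case 3
    have "v \<notin> irregular1" using l v by (auto simp: lowered1_def)
    then obtain e where e: "e \<in> tails" "v = - e" using level1_regular[OF 3] by blast
    then show ?thesis using crd_neg_frame[OF E _ lE, of e] subsets v by (auto split: if_splits)
  next
    case 4
    then show ?thesis using l v by (auto simp: lowered2_def)
  qed
qed

lemma pos_classification:
  assumes l: "l \<in> E" "l \<notin> raised0" "l \<notin> raised1" "l \<notin> raised2" and v: "v \<in> V" "0 < crd E l v"
  shows "v = l \<or> (\<exists>i\<in>tails. head i = l \<and> v = l - i)"
  using v(1)
proof (cases rule: level_cases)
  case 1
  then show ?thesis using crd_frame[OF E 1 l(1)] v by (auto split: if_splits)
next
  case 2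
  have "v \<notin> irregular0" using l v by (auto simp: raised0_def)
  then obtain i where i: "i \<in> tails" "v = head i - i" using 2 by (auto simp: irregular0_def)
  have "crd E l v = (if l = head i then 1 else 0) - (if l = i then 1 else 0)"
    unfolding i(2) using i(1) subsets by (intro crd_difference[OF E _ phi_in(1) l(1)]) auto
  then have "l = head i" using v by (auto split: if_splits)
  then show ?thesis using i by auto
next
  case 3
  have "v \<notin> irregular1" using l v by (auto simp: raised1_def)
  then obtain e where e: "e \<in> tails" "v = - e" using level1_regular[OF 3] by blast
  then show ?thesis using crd_neg_frame[OF E _ l(1), of e] subsets v by (auto split: if_splits)
next
  case 4
  then show ?thesis using l v by (auto simp: raised2_def)
qed

lemma crd_values:
  assumes "l \<in> negated"
  shows "l \<in> V" "- l \<in> V" "head l - l \<in> V" "crd E l l = 1" "crd E l (- l) = -1" "crd E l (head l - l) = -1"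
    "l \<in> E" "head l \<in> E" "head l \<noteq> l" "head l - l \<noteq> - l"
proof -
  have l: "l \<in> tails" "l \<in> E" "- l \<in> V" using assms subsets by (auto simp: negated_def)
  show "l \<in> V" "- l \<in> V" "l \<in> E" "head l \<in> E" "head l \<noteq> l" using l phi_in subsets by auto
  show "head l - l \<in> V" using arrow_level0[OF l(1)] subsets by auto
  show "crd E l l = 1" "crd E l (- l) = -1" using crd_frame[OF E l(2) l(2)] crd_neg_frame[OF E l(2) l(2)] by auto
  show "crd E l (head l - l) = -1" using crd_difference[OF E l(2) phi_in(1)[OF l(1)] l(2)] phi_in(2)[OF l(1)] by auto
  show "head l - l \<noteq> - l" using phi_in(1)[OF l(1)] subsets zero_notin by auto
qed

lemma tail_values:
  assumes "i \<in> tails" "head i = l" "l \<in> E"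
  shows "l - i \<in> V" "crd E l (l - i) = 1"
proof -
  show "l - i \<in> V" using arrow_level0[OF assms(1)] assms subsets by auto
  have "i \<in> E" "l \<noteq> i" using assms phi_in subsets by auto
  then show "crd E l (l - i) = 1" using crd_difference[OF E _ assms(3,3), of i] by simp
qed

text \<open>In a column of sum 0, \<open>l\<close> contributes 1, while \<open>- l\<close> and the
  arrow leaving \<open>l\<close> contribute -1 each. Every arrow entering \<open>l\<close>
  contributes 1, so there is exactly one.\<close>

lemma clean_unique_tail:
  assumes l: "l \<in> clean"
  shows "\<exists>!i. i \<in> tails \<and> head i = l"
proof -
  have lL: "l \<in> negated" and lt: "l \<notin> raised0" "l \<notin> lowered1" "l \<notin> lowered2" "l \<notin> raised1" "l \<notin> raised2" "l \<notin> excess"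
    using l by (auto simp: clean_def)
  note cv = crd_values[OF lL]
  define I where "I = {i \<in> tails. head i = l}"
  have fI: "finite I" using finites by (simp add: I_def)
  define D where "D = (\<lambda>i. l - i) ` I"
  have D: "v \<in> V" "crd E l v = 1" "v \<noteq> l" if "v \<in> D" for v
    using that tail_values[of _ l] cv subsets zero_notin by (auto simp: D_def I_def)
  have cD: "card D = card I" unfolding D_def by (rule card_image) (auto simp: inj_on_def)
  have s0: "colsum l = 0" using lt(6) sigma_nonneg[OF cv(7)] cv(7) by (simp add: excess_def)
  have "colsum l = (\<Sum>v\<in>{l, - l, head l - l} \<union> D. crd E l v)"
    unfolding colsum_def
  proof (rule sum.mono_neutral_right[OF finite_V])
    show "{l, - l, head l - l} \<union> D \<subseteq> V" using cv D by auto
    show "\<forall>v\<in>V - ({l, - l, head l - l} \<union> D). crd E l v = 0"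
    proof
      fix v assume v: "v \<in> V - ({l, - l, head l - l} \<union> D)"
      have "\<not> crd E l v < 0" using neg_classification[of l v] lL negated_sub lt v by auto
      moreover have "\<not> 0 < crd E l v"
        using pos_classification[of l v] cv(7) lt v by (auto simp: D_def I_def)
      ultimately show "crd E l v = 0" by simp
    qed
  qed
  also have "\<dots> = (\<Sum>v\<in>{l, - l, head l - l}. crd E l v) + (\<Sum>v\<in>D. crd E l v)"
    using D cv fI by (intro sum.union_disjoint) (force simp: D_def)+
  also have "(\<Sum>v\<in>{l, - l, head l - l}. crd E l v) = -1"
  proof -
    have "l \<noteq> - l" "l \<noteq> head l - l" using cv by force+
    then show ?thesis using cv by simp
  qed
  also have "(\<Sum>v\<in>D. crd E l v) = int (card I)" using D cD by simp
  finally have "card I = 1" using s0 by simp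
  then obtain i where "I = {i}" by (auto simp: card_1_singleton_iff)
  then have "j \<in> tails \<and> head j = l \<longleftrightarrow> j = i" for j
    unfolding I_def by (auto simp: set_eq_iff)
  then show ?thesis by auto
qed

text \<open>
  Otherwise the four vertices \<open>i\<close>, \<open>- i\<close>, \<open>l - i\<close>, \<open>i - l\<close> cancel in column \<open>i\<close>, and a vertex raising \<open>i\<close>
  would make the sum of that column positive.
\<close>

lemma unpaired_tail:
  assumes l: "l \<in> clean" and i: "i \<in> tails" "head i = l" "i \<notin> clean"
  shows "i \<in> (tails - negated) \<union> (raised0 \<union> lowered1) \<union> lowered2 \<union> excess"
proof (rule ccontr)
  assume "i \<notin> (tails - negated) \<union> (raised0 \<union> lowered1) \<union> lowered2 \<union> excess"
  then have iL: "i \<in> negated" and it: "i \<notin> raised0" "i \<notin> lowered1" "i \<notin> lowered2" "i \<notin> excess" using i by auto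
  then have "i \<in> raised1 \<union> raised2" using i by (auto simp: clean_def)
  then obtain u where u: "u \<in> level1 \<union> lower" "0 < crd E i u"
    by (auto simp: raised1_def raised2_def irregular1_def)
  have du: "2 \<le> depth E u" "u \<in> V" using u by (auto simp: level1_def lower_def)
  have lG: "l \<in> tails" using l negated_sub by (auto simp: clean_def)
  have iE: "i \<in> E" using i subsets by auto
  note cv = crd_values[OF iL]
  have ai: "arrow E i l" using arrow_phi[OF i(1)] i(2) by simp
  have "head l = i" using arrow_involutive[OF E ai arrow_phi[OF lG] cv(2)] .
  note tv = tail_values[OF lG this iE]
  have dl: "depth E (i - l) = 1" using arrowD(1)[OF E arrow_phi[OF lG]] \<open>head l = i\<close> by simp
  define D where "D = {i, - i, l - i, i - l}"
  have fD: "D \<subseteq> V" using cv tv i by (auto simp: D_def)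
  have uD: "u \<notin> D"
    using u(2) du depth_frame[OF E iE] dl cv i(2) by (auto simp: D_def)
  have ne: "i \<noteq> - i" "i \<noteq> l - i" "i \<noteq> i - l" "- i \<noteq> l - i" "- i \<noteq> i - l" "l - i \<noteq> i - l"
    using cv tv i(2) depth_frame[OF E iE] dl by force+
  have "colsum i = (\<Sum>v\<in>D. crd E i v) + (\<Sum>v\<in>V - D. crd E i v)"
    unfolding colsum_def using fD finite_V by (subst sum.subset_diff[of D]) auto
  moreover have "(\<Sum>v\<in>D. crd E i v) = 0"
    using ne cv tv i(2) by (simp add: D_def)
  moreover have "0 < (\<Sum>v\<in>V - D. crd E i v)"
  proof (rule sum_pos2[of _ u])
    show "0 \<le> crd E i v" if "v \<in> V - D" for v
      using neg_classification[OF i(1) it(2,3), of v] that i(2) by (force simp: D_def)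
  qed (use finite_V u du uD in auto)
  ultimately have "0 < colsum i" by simp
  then show False using it(4) iE by (simp add: excess_def)
qed

definition "paired = {l \<in> clean. \<exists>i\<in>clean. head i = l}"

lemma clean_sub: "clean \<subseteq> tails" "clean \<subseteq> E" "clean \<subseteq> negated"
  using negated_sub subsets by (auto simp: clean_def)

text \<open>A clean predecessor \<open>i\<close> of \<open>l\<close> has \<open>- i\<close> among
  the vertices, so \<open>arrow_involutive\<close> yields \<open>head l = i\<close>: predecessor and
  head coincide.\<close>

lemma paired_pair:
  assumes "l \<in> paired"
  shows "l \<in> clean" "head l \<in> paired" "head (head l) = l"
proof -
  obtain i where i: "l \<in> clean" "i \<in> clean" "head i = l" using assms by (auto simp: paired_def)
  have tails: "l \<in> tails" "i \<in> tails" using i clean_sub by auto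
  have ai: "arrow E i l" using arrow_phi[OF tails(2)] i(3) by simp
  have "head l = i" using arrow_involutive[OF E ai arrow_phi[OF tails(1)] crd_values(2)] i clean_sub by auto
  then show "l \<in> clean" "head l \<in> paired" "head (head l) = l" using i by (auto simp: paired_def)
qed

lemma paired_vertices:
  assumes "l \<in> paired"
  shows "{v \<in> V. crd E l v \<noteq> 0} = {l, - l, head l - l, l - head l}"
proof -
  have l: "l \<in> clean" "head l \<in> clean" "head (head l) = l" using paired_pair assms by (auto simp: paired_def)
  have lL: "l \<in> negated" "head l \<in> tails" "l \<in> tails" using l clean_sub by auto
  note cv = crd_values[OF lL(1)]
  note tv = tail_values[OF lL(2) l(3) cv(7)]
  have "v \<in> {l, - l, head l - l, l - head l}" if v: "v \<in> V" "crd E l v \<noteq> 0" for v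
  proof (cases "crd E l v < 0")
    case True
    then show ?thesis using neg_classification[of l v] lL l v by (auto simp: clean_def)
  next
    case False
    then have "v = l \<or> (\<exists>i\<in>tails. head i = l \<and> v = l - i)"
      using pos_classification[of l v] cv(7) l v by (auto simp: clean_def)
    moreover have "i = head l" if "i \<in> tails" "head i = l" for i
      using clean_unique_tail[OF l(1)] that lL(2) l(3) by blast
    ultimately show ?thesis by auto
  qed
  then show ?thesis using cv tv by auto
qed

lemma card_E_minus_paired: "int (card (E - paired)) \<le> 12 * k\<^sup>2 + 22 * k"
proof -
  define Z where "Z = (tails - negated) \<union> (raised0 \<union> lowered1) \<union> lowered2 \<union> excess"
  define b l s where "b = int (card nontails)" and "l = defect" and "s = (\<Sum>e\<in>E. colsum e)"
  have fin: "finite raised0" "finite lowered1" "finite lowered2" "finite raised1" "finite raised2" "finite excess" "finite negated" "finite clean"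
    using finites clean_sub finite_subset by (auto simp: raised0_def lowered1_def lowered2_def raised1_def raised2_def excess_def negated_def)
  have cZ: "card Z \<le> card (tails - negated) + card (raised0 \<union> lowered1) + card lowered2 + card excess"
    unfolding Z_def by (meson add_le_mono card_Un_le le_refl order_trans)
  have Zb: "int (card Z) \<le> k + l + b * b + 6 * l + s"
    using cZ card_tails_minus_negated card_raised0_lowered1 card_lowered2 card_excess by (simp add: b_def l_def s_def)
  have "E - clean \<subseteq> nontails \<union> Z \<union> raised1 \<union> raised2"
    by (auto simp: nontails_def Z_def clean_def negated_def)
  then have "card (E - clean) \<le> card (nontails \<union> Z \<union> raised1 \<union> raised2)"
    using finites fin by (intro card_mono) (auto simp: Z_def)
  also have "\<dots> \<le> card nontails + card Z + card raised1 + card raised2"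
    by (meson add_le_mono card_Un_le le_refl order_trans)
  finally have EC: "int (card (E - clean)) \<le> b + int (card Z) + b * b + (b + 2) * (3 * l)"
    using card_raised1 card_raised2 unfolding b_def l_def by (smt (verit, best) of_nat_add of_nat_le_iff of_nat_mult)
  \<comment> \<open>A clean index fails to be paired only if its predecessor lies in
    \<open>Z\<close>. These losses are charged to \<open>Z\<close> a second time, hence the factor 2
    below.\<close>
  have "card (clean - paired) \<le> card Z"
  proof -
    have "\<exists>i\<in>Z. head i = x" if "x \<in> clean - paired" for x
    proof -
      obtain i where i: "i \<in> tails" "head i = x" using clean_unique_tail[of x] \<open>x \<in> clean - paired\<close> by auto
      then have "i \<notin> clean" using \<open>x \<in> clean - paired\<close> by (auto simp: paired_def)
      then show ?thesis using unpaired_tail[of x i] i \<open>x \<in> clean - paired\<close> by (auto simp: Z_def)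
    qed
    then have "clean - paired \<subseteq> head ` Z" by blast
    then show ?thesis using finites fin by (intro surj_card_le) (auto simp: Z_def)
  qed
  moreover have "card (E - paired) \<le> card (E - clean) + card (clean - paired)"
    using card_Un_le[of "E - clean" "clean - paired"] card_mono[of "(E - clean) \<union> (clean - paired)" "E - paired"] finites fin by fastforce
  ultimately have "int (card (E - paired)) \<le> b + 2 * int (card Z) + b * b + (b + 2) * (3 * l)"
    using EC by linarith
  also have "\<dots> \<le> b + 2 * (k + l + b * b + 6 * l + s) + b * b + (b + 2) * (3 * l)"
    using Zb by simp
  also have "\<dots> = b + 3 * (b * b) + 3 * (b * l) + 20 * l + 2 * k + 2 * s"
    by (simp add: algebra_simps)
  also have "\<dots> \<le> 12 * k\<^sup>2 + 22 * k"
  proof -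
    have b0: "0 \<le> b" "0 \<le> l" "0 \<le> s"
      using sum_sigma_nonneg card_lower_le by (auto simp: b_def l_def s_def)
    \<comment> \<open>By \<open>balance\<close>, \<open>m\<close> is the shortage of vertices of
      depth 1. With \<open>k = m + l + s\<close> and \<open>b \<le> 2 * m\<close>, the coefficient
      12 comes from \<open>3 * (b * b)\<close> and the coefficient 22 from
      \<open>20 * l + 2 * k\<close>.\<close>
    define m where "m = k - l - s"
    have bm: "b \<le> 2 * m" using card_nontails_le(1) by (simp add: b_def l_def s_def m_def)
    have m0: "0 \<le> m" using bm b0 by simp
    have k: "k = m + l + s" by (simp add: m_def)
    have bb: "b * b \<le> 4 * (m * m)" using mult_mono[OF bm bm] b0 m0 by simp
    have bl: "b * l \<le> 2 * (m * l)" using mult_right_mono[OF bm b0(2)] by simp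
    have nn: "0 \<le> m * l" "0 \<le> m * s" "0 \<le> l * l" "0 \<le> s * s" "0 \<le> l * s" using b0 m0 by simp_all
    have "k\<^sup>2 = m * m + l * l + s * s + 2 * (m * l) + 2 * (m * s) + 2 * (l * s)"
      unfolding k by (simp add: power2_eq_square algebra_simps)
    with bm bb bl nn b0 m0 k show ?thesis by linarith
  qed
  finally show ?thesis .
qed

theorem hexagonal_pairs:
  "\<exists>M \<phi>. M \<subseteq> E \<and> int (card (E - M)) \<le> 12 * k\<^sup>2 + 22 * k \<and>
    (\<forall>l\<in>M. \<phi> l \<in> M \<and> \<phi> l \<noteq> l \<and> \<phi> (\<phi> l) = l \<and> {v \<in> V. crd E l v \<noteq> 0} = {l, - l, \<phi> l - l, l - \<phi> l})"
proof (intro exI[of _ paired] exI[of _ head] conjI ballI)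
  show "paired \<subseteq> E" using clean_sub by (auto simp: paired_def)
  show "head l \<noteq> l" if "l \<in> paired" for l
    using phi_in(2) paired_pair(1)[OF that] clean_sub(1) by blast
qed (simp_all only: card_E_minus_paired paired_pair paired_vertices)

end

subsection \<open>Facets of a smooth Fano polytope\<close>

lemma linear_functional_inner:
  fixes f :: "'a::euclidean_space \<Rightarrow> real"
  assumes "linear f"
  shows "\<exists>a. \<forall>x. f x = a \<bullet> x"
  using adjoint_works[OF assms, of _ 1] by (metis inner_commute inner_real_def mult_1_right)

lemma linear_le_convex_hull:
  fixes f :: "'a::real_vector \<Rightarrow> real"
  assumes "linear f" "\<And>v. v \<in> V \<Longrightarrow> f v \<le> c" "x \<in> convex hull V"
  shows "f x \<le> c"
proof -
  have "convex {x. f x \<le> c}"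
    using convex_linear_vimage[OF assms(1), of "{..c}"] by (simp add: vimage_def)
  then have "convex hull V \<subseteq> {x. f x \<le> c}" using assms(2) by (intro hull_minimal) auto
  then show ?thesis using assms(3) by auto
qed

lemma polytope_hull_vertices:
  fixes P :: "'a::euclidean_space set"
  assumes "polytope P"
  shows "P = convex hull (vertices P)" "finite (vertices P)"
  using Krein_Milman_Minkowski[OF polytope_imp_compact polytope_imp_convex] assms
    finite_polyhedron_extreme_points[OF polytope_imp_polyhedron]
  by (auto simp: vertices_def)

lemma level_face:
  fixes P :: "'a::euclidean_space set"
  assumes P: "polytope P" and f: "linear f" and le: "\<And>v. v \<in> vertices P \<Longrightarrow> f v \<le> (1::real)"
  shows "(P \<inter> {x. f x = 1}) face_of P"
    and "vertices (P \<inter> {x. f x = 1}) = {v \<in> vertices P. f v = 1}"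
    and "P \<inter> {x. f x = 1} = convex hull {v \<in> vertices P. f v = 1}"
proof -
  obtain a where a: "\<And>x. f x = a \<bullet> x" using linear_functional_inner[OF f] by blast
  have leP: "f x \<le> 1" if "x \<in> P" for x
    using linear_le_convex_hull[OF f le] that polytope_hull_vertices(1)[OF P] by blast
  show face: "(P \<inter> {x. f x = 1}) face_of P"
    using face_of_Int_supporting_hyperplane_le[of P a 1] polytope_imp_convex[OF P] leP a by auto
  show vert: "vertices (P \<inter> {x. f x = 1}) = {v \<in> vertices P. f v = 1}"
    using extreme_point_of_face[OF face] by (auto simp: vertices_def extreme_point_of_def)
  have "polytope (P \<inter> {x. f x = 1})" using face_of_polytope_polytope[OF P face] .
  from polytope_hull_vertices(1)[OF this]
  show "P \<inter> {x. f x = 1} = convex hull {v \<in> vertices P. f v = 1}" by (simp add: vert)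
qed

lemma span_convex_hull: "span (convex hull S) = span S"
proof (rule antisym)
  show "span (convex hull S) \<subseteq> span S"
    by (simp add: convex_hull_subset_span span_minimal)
  show "span S \<subseteq> span (convex hull S)" by (intro span_mono hull_subset)
qed

text \<open>The hyperplane misses the origin, so adjoining 0 raises the affine dimension by one, to
  the linear dimension. This turns the codimension condition on facets into a spanning
  condition.\<close>

lemma aff_dim_level:
  fixes S :: "'a::euclidean_space set"
  assumes f: "linear f" and S: "\<And>x. x \<in> S \<Longrightarrow> f x = (1::real)"
  shows "aff_dim S = int (dim S) - 1"
proof -
  obtain a where "\<And>x. f x = a \<bullet> x" using linear_functional_inner[OF f] by blast
  then have "affine {x. f x = 1}" by (simp add: affine_hyperplane)
  then have "affine hull S \<subseteq> {x. f x = 1}" using S by (intro hull_minimal) auto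
  then have "0 \<notin> affine hull S" using linear_0[OF f] by auto
  then have "aff_dim (insert 0 S) = aff_dim S + 1" by (simp add: aff_dim_insert)
  moreover have "aff_dim (insert 0 S) = int (dim (insert 0 S))"
    by (intro aff_dim_zero hull_inc) simp
  moreover have "dim (insert 0 S) = dim S" by (metis dim_span span_insert_0)
  ultimately show ?thesis by simp
qed

lemma level_facet:
  fixes P :: "'a::euclidean_space set"
  assumes P: "polytope P" "affine hull P = span N" and f: "linear f"
    and le: "\<And>v. v \<in> vertices P \<Longrightarrow> f v \<le> (1::real)"
    and sp: "span {v \<in> vertices P. f v = 1} = span N" and ne: "\<exists>v\<in>vertices P. f v = 1"
  shows "(P \<inter> {x. f x = 1}) facet_of P" "vertices (P \<inter> {x. f x = 1}) = {v \<in> vertices P. f v = 1}"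
proof -
  note lf = level_face[OF P(1) f le]
  have "aff_dim (P \<inter> {x. f x = 1}) = int (dim (P \<inter> {x. f x = 1})) - 1"
    by (intro aff_dim_level[OF f]) auto
  also have "dim (P \<inter> {x. f x = 1}) = dim (span {v \<in> vertices P. f v = 1})"
    using dim_span[of "convex hull {v \<in> vertices P. f v = 1}"] by (simp only: lf(3) span_convex_hull)
  also note sp
  also have "int (dim (span N)) = aff_dim P"
    using aff_dim_affine_hull[of P] aff_dim_subspace[of "span N"] P(2) by (simp del: aff_dim_affine_hull)
  finally show "(P \<inter> {x. f x = 1}) facet_of P"
    using lf(1) ne by (auto simp: facet_of_def vertices_def extreme_point_of_def)
  show "vertices (P \<inter> {x. f x = 1}) = {v \<in> vertices P. f v = 1}" by (rule lf)
qed

lemma facet_functional: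
  fixes P :: "'a::euclidean_space set"
  assumes P: "polytope P" "affine hull P = span N" "0 \<in> rel_interior P" and F: "F facet_of P"
  obtains f where "linear f" "\<And>x. x \<in> P \<Longrightarrow> f x \<le> (1::real)" "F = P \<inter> {x. f x = 1}" "span F = span N"
proof -
  have face: "F face_of P" "F \<noteq> {}" "aff_dim F = aff_dim P - 1" using F by (auto simp: facet_of_def)
  have "F exposed_face_of P"
    using exposed_face_of_polyhedron[OF polytope_imp_polyhedron[OF P(1)]] face by simp
  then obtain a b where ab: "P \<subseteq> {x. a \<bullet> x \<le> b}" "F = P \<inter> {x. a \<bullet> x = b}"
    by (auto simp: exposed_face_of_def)
  have "0 \<in> P" using P(3) rel_interior_subset by blast
  moreover have "F \<inter> rel_interior P = {}"
    using F by (intro face_of_disjoint_rel_interior[OF face(1)]) auto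
  \<comment> \<open>A proper face avoids the relative interior point 0, so the right-hand side is
    positive and the functional can be scaled to take the value 1 on the facet.\<close>
  ultimately have b: "0 < b" using ab P(3) by force
  define f where "f x = (a /\<^sub>R b) \<bullet> x" for x
  have lin: "linear f" unfolding f_def by (intro bounded_linear.linear bounded_linear_inner_right) 
  have le: "f x \<le> 1" if "x \<in> P" for x using ab b that by (auto simp: f_def field_simps)
  have Feq: "F = P \<inter> {x. f x = 1}" using ab(2) b by (auto simp: f_def field_simps)
  have "int (dim F) = aff_dim P"
    using aff_dim_level[OF lin, of F] Feq face(3) by auto
  also have "aff_dim P = int (dim (span N))"
    using aff_dim_affine_hull[of P] aff_dim_subspace[of "span N"] P(2) by (simp del: aff_dim_affine_hull)
  finally have "dim F = dim (span N)" by simp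
  moreover have "F \<subseteq> span N" using Feq P(2) hull_subset[of P affine] by auto
  ultimately have "span F = span N"
    using dim_eq_span[of F "span N"] by simp
  show ?thesis by (rule that[OF lin le Feq \<open>span F = span N\<close>])
qed

section \<open>Vertex sets of facets and the exchange across a ridge\<close>

definition frames :: "'a::euclidean_space set \<Rightarrow> 'a set set" where
  "frames P = {vertices F | F. F facet_of P}"

lemma vertices_face:
  assumes "F face_of P"
  shows "vertices F = vertices P \<inter> F"
  using extreme_point_of_face[OF assms] by (auto simp: vertices_def)

lemma smooth_fanoD:
  assumes "smooth_fano d N P"
  shows "lattice_of_rank d N" "polytope P" "affine hull P = span N" "vertices P \<subseteq> N" "0 \<in> rel_interior P"
    "\<And>F. F facet_of P \<Longrightarrow> lattice_basis (vertices F) N"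
  using assms by (auto simp: smooth_fano_def)

lemma frame_basis_fano: "smooth_fano d N P \<Longrightarrow> E \<in> frames P \<Longrightarrow> lattice_basis E N"
  using smooth_fanoD(6) by (auto simp: frames_def)

lemma frame_of_functional:
  assumes P: "smooth_fano d N P" and f: "linear f" and le: "\<And>v. v \<in> vertices P \<Longrightarrow> f v \<le> (1::real)"
    and sp: "span {v \<in> vertices P. f v = 1} = span N" and ne: "\<exists>v\<in>vertices P. f v = 1"
  shows "{v \<in> vertices P. f v = 1} \<in> frames P"
  using level_facet[OF smooth_fanoD(2,3)[OF P] f le sp ne] unfolding frames_def by blast

lemma frame_functional:
  assumes P: "smooth_fano d N P" and E: "E \<in> frames P"
  obtains f where "linear f" "\<And>v. v \<in> P \<Longrightarrow> f v \<le> (1::real)" "E = {v \<in> vertices P. f v = 1}"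
    "\<And>x. x \<in> N \<Longrightarrow> real_of_int (depth E x) = 1 - f x"
proof -
  obtain F where F: "F facet_of P" "E = vertices F" using E by (auto simp: frames_def)
  obtain f where f: "linear f" "\<And>x. x \<in> P \<Longrightarrow> f x \<le> (1::real)" "F = P \<inter> {x. f x = 1}"
    using facet_functional[OF smooth_fanoD(2,3,5)[OF P] F(1)] by blast
  have Eeq: "E = {v \<in> vertices P. f v = 1}"
    using vertices_face[of F P] F f(3) by (auto simp: facet_of_def vertices_def extreme_point_of_def)
  note b = frame_basis_fano[OF P E]
  have "real_of_int (depth E x) = 1 - f x" if "x \<in> N" for x
  proof -
    have "f x = f (\<Sum>e\<in>E. of_int (crd E e x) *\<^sub>R e)" using lattice_basis_crd[OF b that] by simp
    also have "\<dots> = (\<Sum>e\<in>E. of_int (crd E e x) * f e)" by (simp add: linear_sum[OF f(1)] linear_scale[OF f(1)])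
    also have "\<dots> = (\<Sum>e\<in>E. of_int (crd E e x))" by (rule sum.cong[OF refl]) (use Eeq in simp)
    finally show ?thesis by (simp add: depth_def)
  qed
  from that[OF f(1,2) Eeq this] show ?thesis .
qed

text \<open>Otherwise the coordinate at \<open>e\<close> is nonnegative on \<open>P\<close> and
  vanishes at the relative interior point 0, hence on all of \<open>P\<close>; but it is 1 at
  \<open>e\<close>.\<close>

lemma exists_negative_crd:
  assumes P: "smooth_fano d N P" and E: "E \<in> frames P" "e \<in> E"
  shows "\<exists>v\<in>vertices P. crd E e v < 0"
proof (rule ccontr)
  assume a: "\<not> ?thesis"
  note b = frame_basis_fano[OF P E(1)]
  note D = smooth_fanoD[OF P]
  obtain g where g: "\<And>e. linear (g e)" "\<And>e x. e \<in> E \<Longrightarrow> x \<in> N \<Longrightarrow> g e x = real_of_int (crd E e x)"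
    using dual_functionals[OF b] by blast
  have lin: "linear (\<lambda>x. - g e x)" by (intro linear_compose_neg g)
  have "- g e x \<le> 0" if "x \<in> P" for x
  proof (rule linear_le_convex_hull[OF lin])
    show "- g e v \<le> 0" if "v \<in> vertices P" for v
      using a that g(2)[OF E(2)] D(4) by (force simp: not_less)
    show "x \<in> convex hull (vertices P)" using that polytope_hull_vertices(1)[OF D(2)] by simp
  qed
  moreover obtain a where ga: "\<And>x. - g e x = a \<bullet> x" using linear_functional_inner[OF lin] by blast
  ultimately have "(P \<inter> {x. a \<bullet> x = 0}) face_of P"
    by (intro face_of_Int_supporting_hyperplane_le polytope_imp_convex D) auto
  moreover have "0 \<in> (P \<inter> {x. a \<bullet> x = 0}) \<inter> rel_interior P" using D(5) rel_interior_subset by auto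
  ultimately have "P \<inter> {x. a \<bullet> x = 0} = P" using face_of_disjoint_rel_interior by blast
  moreover have "e \<in> P" using E D by (auto simp: frames_def vertices_def facet_of_def extreme_point_of_def dest: face_of_imp_subset)
  ultimately have "a \<bullet> e = 0" by blast
  then have "g e e = 0" using ga[of e] by simp
  moreover have "g e e = 1"
    using g(2)[OF E(2)] lattice_basis_subset[OF b E(2)] crd_basis[OF b E(2) E(2)] by simp
  ultimately show False by simp
qed

text \<open>
  Tilt the functional \<open>f\<close> of the facet by a multiple of the coordinate \<open>g e\<close> until it hits the next vertex.
\<close>

lemma frame_pivot:
  assumes P: "smooth_fano d N P" and E: "E \<in> frames P" and e: "e \<in> E"
  shows "\<exists>e'\<in>vertices P - E. insert e' (E - {e}) \<in> frames P"
proof -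
  note D = smooth_fanoD[OF P]
  note b = frame_basis_fano[OF P E(1)]
  have fin: "finite E" "independent E" using b by (auto simp: lattice_basis_def)
  obtain f where f: "linear f" "\<And>v. v \<in> P \<Longrightarrow> f v \<le> (1::real)" "E = {v \<in> vertices P. f v = 1}"
    using frame_functional[OF P E] by blast
  obtain g where g: "\<And>e. linear (g e)" "\<And>e x. e \<in> E \<Longrightarrow> x \<in> N \<Longrightarrow> g e x = real_of_int (crd E e x)"
    using dual_functionals[OF b] by blast
  have VP: "v \<in> P" "v \<in> N" if "v \<in> vertices P" for v
    using that D(4) by (auto simp: vertices_def extreme_point_of_def)
  have EN: "j \<in> N" if "j \<in> E" for j using lattice_basis_subset[OF b that] .
  have gE: "g e j = (if j = e then 1 else 0)" if "j \<in> E" for j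
    using g(2)[OF e EN[OF that]] crd_basis[OF b that e] by auto
  define X where "X = {v \<in> vertices P. g e v < 0}"
  have X: "finite X" "X \<noteq> {}"
    using polytope_hull_vertices(2)[OF D(2)] exists_negative_crd[OF P E e] g(2)[OF e] VP(2)
    by (auto simp: X_def)
  \<comment> \<open>\<open>r v\<close> solves \<open>f v - t * g e v = 1\<close> for
    \<open>t\<close>. The least solution is the first contact, so no vertex has passed level 1
    yet.\<close>
  define r where "r v = (1 - f v) / (- g e v)" for v
  have "Min (r ` X) \<in> r ` X" using X by (intro Min_in) auto
  then obtain e' where e'X: "e' \<in> X" "r e' = Min (r ` X)" by auto
  then have e': "e' \<in> X" "\<And>v. v \<in> X \<Longrightarrow> r e' \<le> r v" using X by auto
  define t where "t = r e'"
  have e'n: "g e e' < 0" "e' \<in> vertices P" using e' by (auto simp: X_def)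
  have t0: "0 \<le> t" unfolding t_def r_def using e'n f(2)[OF VP(1)[OF e'n(2)]] by (intro divide_nonneg_pos) auto
  define u where "u v = f v - t * g e v" for v
  have ulin: "linear u" unfolding u_def
    by (intro linear_compose_sub f linear_compose_scale_right[of "g e" t, simplified] g)
  have ule: "u v \<le> 1" if v: "v \<in> vertices P" for v
  proof (cases "g e v < 0")
    case True
    then have "t \<le> r v" using e' v by (auto simp: X_def t_def)
    then show ?thesis using True by (simp add: r_def u_def field_simps)
  next
    case False
    then have "0 \<le> t * g e v" using t0 by simp
    then show ?thesis using f(2)[OF VP(1)[OF v]] by (simp add: u_def)
  qed
  have ue': "u e' = 1" using e'n by (simp add: u_def t_def r_def)
  have uE: "u j = 1" if "j \<in> E - {e}" for j using that gE f(3) by (auto simp: u_def)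
  define S where "S = {v \<in> vertices P. u v = 1}"
  define E' where "E' = insert e' (E - {e})"
  have ES: "E' \<subseteq> S" using ue' uE e'n f(3) by (auto simp: S_def E'_def)
  have e'E: "e' \<notin> E" using gE e'n by (auto split: if_splits)
  have "e \<in> span E'"
  proof -
    have "e' = (\<Sum>j\<in>E. of_int (crd E j e') *\<^sub>R j)" using lattice_basis_crd[OF b VP(2)[OF e'n(2)]] .
    also have "\<dots> = of_int (crd E e e') *\<^sub>R e + (\<Sum>j\<in>E-{e}. of_int (crd E j e') *\<^sub>R j)"
      using fin e by (subst sum.remove[of E e]) auto
    finally have "of_int (crd E e e') *\<^sub>R e = e' - (\<Sum>j\<in>E-{e}. of_int (crd E j e') *\<^sub>R j)" by (simp add: algebra_simps)
    moreover have "e' - (\<Sum>j\<in>E-{e}. of_int (crd E j e') *\<^sub>R j) \<in> span E'"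
      by (intro span_diff span_sum span_scale span_base) (auto simp: E'_def)
    ultimately have "of_int (crd E e e') *\<^sub>R e \<in> span E'" by simp
    then have "inverse (of_int (crd E e e')) *\<^sub>R (of_int (crd E e e') *\<^sub>R e) \<in> span E'" by (rule span_scale)
    moreover have "real_of_int (crd E e e') \<noteq> 0" using g(2)[OF e VP(2)[OF e'n(2)]] e'n by simp
    ultimately show ?thesis by simp
  qed
  moreover have "E - {e} \<subseteq> span E'" by (rule order_trans[OF _ span_superset]) (auto simp: E'_def)
  ultimately have "E \<subseteq> span E'" by blast
  then have "span E \<subseteq> span E'" by (rule span_minimal[OF _ subspace_span])
  then have "span N \<subseteq> span E'" using lattice_basis_span[OF b] by simp
  moreover have "span E' \<subseteq> span S" using ES by (rule span_mono)
  moreover have "span S \<subseteq> span N" using VP(2) by (intro span_mono) (auto simp: S_def)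
  ultimately have sp: "span S = span N" by blast
  have SF: "S \<in> frames P"
    unfolding S_def using sp ue' e'n by (intro frame_of_functional[OF P ulin ule]) (auto simp: S_def)
  \<comment> \<open>Several vertices could be hit at once. But \<open>S\<close> is the vertex set of
    a facet, hence a lattice basis of the same size as \<open>E\<close>, which rules out
    ties.\<close>
  have "card S = card E" using lattice_basis_card[OF frame_basis_fano[OF P SF] b] .
  moreover have "card E' = Suc (card (E - {e}))" using fin e'E by (simp add: E'_def)
  then have "card E' = card E" using card_Suc_Diff1[OF fin(1) e] by (rule trans)
  moreover have "finite S" using frame_basis_fano[OF P SF] by (simp add: lattice_basis_def)
  ultimately have "E' = S" by (intro card_subset_eq[OF _ ES]) auto
  then show ?thesis using SF e'E e'n by (auto simp: E'_def)
qed

lemma fano_frames_frames: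
  assumes P: "smooth_fano d N P"
  shows "fano_frames N (vertices P) (frames P)"
proof
  note D = smooth_fanoD[OF P]
  show "finite (vertices P)" using polytope_hull_vertices(2)[OF D(2)] .
  show "vertices P \<subseteq> N" by (rule D)
  fix E assume E: "E \<in> frames P"
  obtain f where f: "\<And>v. v \<in> P \<Longrightarrow> f v \<le> (1::real)" "E = {v \<in> vertices P. f v = 1}"
    "\<And>x. x \<in> N \<Longrightarrow> real_of_int (depth E x) = 1 - f x"
    using frame_functional[OF P E] by blast
  show "E \<subseteq> vertices P" using f(2) by auto
  show "lattice_basis E N" using frame_basis_fano[OF P E] .
  fix v assume v: "v \<in> vertices P"
  then have vp: "v \<in> P" "v \<in> N" using D(4) by (auto simp: vertices_def extreme_point_of_def)
  show "0 \<le> depth E v" using f(1)[OF vp(1)] f(3)[OF vp(2)] by simp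
  show "v \<in> E" if "depth E v = 0" using that f(2) f(3)[OF vp(2)] v by simp
next
  show "\<exists>e'\<in>vertices P - E. insert e' (E - {e}) \<in> frames P" if "E \<in> frames P" "e \<in> E" for E e
    using frame_pivot[OF P that] .
qed

text \<open>The ray through the sum of all vertices leaves \<open>P\<close> in some facet; a
  positive multiple of the sum is then a convex combination of the vertices of that facet.\<close>

lemma special_frame_exists:
  assumes P: "smooth_fano d N P" and d: "0 < d"
  obtains E where "E \<in> frames P" "\<And>e. e \<in> E \<Longrightarrow> 0 \<le> (\<Sum>v\<in>vertices P. crd E e v)"
proof -
  note D = smooth_fanoD[OF P]
  obtain B where B: "lattice_basis B N" "card B = d" using D(1) by (auto simp: lattice_of_rank_def)
  then have "B \<noteq> {}" using d by auto
  then obtain b where b: "b \<in> B" by blast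
  have "independent B" using B by (simp add: lattice_basis_def)
  then have b0: "b \<noteq> 0" "b \<in> N" using b dependent_zero[of B] lattice_basis_subset[OF B(1) b] by auto
  define w where "w = \<Sum>(vertices P)"
  have wN: "w \<in> N" unfolding w_def
    using lattice_sum[OF B(1), of "vertices P" "\<lambda>v. v" "\<lambda>_. 1"] D(4) by auto
  \<comment> \<open>A vanishing sum gives no direction; any nonzero lattice vector then serves,
    since all coordinates of the sum are 0 in every basis.\<close>
  define l where "l = (if w = 0 then b else w)"
  have l: "l \<noteq> 0" "l \<in> N" using b0 wN by (auto simp: l_def)
  have "0 + l \<in> affine hull P" using l D(3) by (simp add: span_base)
  then obtain t where t: "0 < t" "0 + t *\<^sub>R l \<in> rel_frontier P"
    using ray_to_rel_frontier[OF polytope_imp_bounded[OF D(2)] D(5) _ l(1)] by blast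
  then obtain F where F: "F facet_of P" "t *\<^sub>R l \<in> F"
    using rel_frontier_of_polyhedron[OF polytope_imp_polyhedron[OF D(2)]] by auto
  define E where "E = vertices F"
  have E: "E \<in> frames P" using F by (auto simp: frames_def E_def)
  note bas = frame_basis_fano[OF P E]
  obtain g where g: "\<And>e. linear (g e)" "\<And>e x. e \<in> E \<Longrightarrow> x \<in> N \<Longrightarrow> g e x = real_of_int (crd E e x)"
    using dual_functionals[OF bas] by blast
  have "F = convex hull E"
    using polytope_hull_vertices(1)[of F] face_of_polytope_polytope[OF D(2)] F(1) by (auto simp: E_def facet_of_def)
  then have tl: "t *\<^sub>R l \<in> convex hull E" using F(2) by simp
  have "0 \<le> (\<Sum>v\<in>vertices P. crd E e v)" if e: "e \<in> E" for e
  proof -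
    have "- g e (t *\<^sub>R l) \<le> 0"
    proof (rule linear_le_convex_hull[OF _ _ tl])
      show "linear (\<lambda>x. - g e x)" by (intro linear_compose_neg g)
      show "- g e j \<le> 0" if "j \<in> E" for j
        using g(2)[OF e lattice_basis_subset[OF bas that]] crd_basis[OF bas that e] by simp
    qed
    then have "0 \<le> g e l" using t(1) by (simp add: linear_scale[OF g(1)] zero_le_mult_iff)
    then have "0 \<le> g e w" using linear_0[OF g(1)] by (auto simp: l_def split: if_splits)
    then have "0 \<le> crd E e w" using g(2)[OF e wN] by simp
    then show ?thesis unfolding w_def using crd_sum[OF bas _ e] D(4) by (simp add: subset_iff)
  qed
  with E show ?thesis by (rule that)
qed

lemma zero_not_vertex:
  assumes P: "smooth_fano d N P" and d: "0 < d"
  shows "0 \<notin> vertices P"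
proof
  assume "0 \<in> vertices P"
  then have "P = {0}"
    using extreme_point_not_in_REL_INTERIOR[of 0 P] smooth_fanoD(5)[OF P] by (auto simp: vertices_def)
  obtain B where B: "lattice_basis B N" "card B = d" using smooth_fanoD(1)[OF P] by (auto simp: lattice_of_rank_def)
  then have "B \<noteq> {}" using d by auto
  then obtain b where b: "b \<in> B" by blast
  have "independent B" using B by (simp add: lattice_basis_def)
  then have "b \<noteq> 0" "b \<in> N" using b dependent_zero[of B] lattice_basis_subset[OF B(1) b] by auto
  moreover have "span N = {0}" using smooth_fanoD(3)[OF P] \<open>P = {0}\<close> by simp
  ultimately show False using span_base[of b N] by simp
qed

subsection \<open>Splitting off hexagons\<close>

lemma lookup_scaleR: "Poly_Mapping.lookup (r *\<^sub>R x) i = r *\<^sub>R Poly_Mapping.lookup x i"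
proof -
  have "finite {i. r *\<^sub>R Poly_Mapping.lookup x i \<noteq> 0}"
    by (rule finite_subset[OF _ finite_lookup[of x]]) auto
  then show ?thesis by (simp add: scaleR_poly_mapping_def Abs_poly_mapping_inverse)
qed

lemma linear_single: "linear (Poly_Mapping.single m :: 'a::real_vector \<Rightarrow> _)"
proof (rule linearI)
  show "Poly_Mapping.single m (x + y) = Poly_Mapping.single m x + Poly_Mapping.single m y" for x y :: 'a
    by (rule single_add)
  show "Poly_Mapping.single m (r *\<^sub>R x) = r *\<^sub>R Poly_Mapping.single m x" for r and x :: 'a
    by (rule poly_mapping_eqI) (simp add: lookup_scaleR lookup_single when_def)
qed

lemma linear_append_coord: "linear (append_coord m)"
  unfolding append_coord_def case_prod_beta
  by (intro linear_compose_add linear_compose[OF linear_snd linear_single, unfolded o_def] linear_fst)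

lemma lattice_power_eq:
  "lattice_power f N = {\<Sum>m<f. Poly_Mapping.single m (y m) | y. \<forall>m<f. y m \<in> N}"
proof (induction f)
  case (Suc f)
  show ?case
  proof (intro equalityI subsetI)
    fix z assume "z \<in> lattice_power (Suc f) N"
    then obtain y w where y: "\<forall>m<f. y m \<in> N" "w \<in> N" "z = (\<Sum>m<f. Poly_Mapping.single m (y m)) + Poly_Mapping.single f w"
      by (auto simp: Suc append_coord_def)
    have "z = (\<Sum>m<Suc f. Poly_Mapping.single m ((y(f := w)) m))" using y(3) by simp
    moreover have "\<forall>m<Suc f. (y(f := w)) m \<in> N" using y by (auto simp: less_Suc_eq)
    ultimately show "z \<in> {\<Sum>m<Suc f. Poly_Mapping.single m (y m) | y. \<forall>m<Suc f. y m \<in> N}" by blast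
  next
    fix z assume "z \<in> {\<Sum>m<Suc f. Poly_Mapping.single m (y m) | y. \<forall>m<Suc f. y m \<in> N}"
    then obtain y where y: "\<forall>m<Suc f. y m \<in> N" "z = (\<Sum>m<Suc f. Poly_Mapping.single m (y m))" by blast
    then have "(\<Sum>m<f. Poly_Mapping.single m (y m)) \<in> lattice_power f N" "y f \<in> N" by (auto simp: Suc)
    then have "append_coord f (\<Sum>m<f. Poly_Mapping.single m (y m), y f) \<in> lattice_power (Suc f) N" by auto
    then show "z \<in> lattice_power (Suc f) N" using y by (simp add: append_coord_def)
  qed
qed simp

lemma direct_sum_hulls:
  "direct_sum (convex hull X) (convex hull Y) = convex hull (X \<times> {0} \<union> {0} \<times> Y)"
proof -
  have "linear (\<lambda>x::'a. (x, 0::'b))" "linear (\<lambda>y::'b. (0::'a, y))"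
    by (auto intro!: linearI)
  note l = this[THEN convex_hull_linear_image]
  have "(convex hull X) \<times> {0::'b} = (\<lambda>x. (x, 0)) ` (convex hull X)" by auto
  also have "\<dots> = convex hull (X \<times> {0::'b})"
    unfolding l by (rule arg_cong[where f = "\<lambda>S. convex hull S"]) auto
  finally have eq1: "(convex hull X) \<times> {0::'b} = convex hull (X \<times> {0::'b})" .
  have "{0::'a} \<times> (convex hull Y) = (\<lambda>y. (0, y)) ` (convex hull Y)" by auto
  also have "\<dots> = convex hull ({0::'a} \<times> Y)"
    unfolding l by (rule arg_cong[where f = "\<lambda>S. convex hull S"]) auto
  finally have eq: "{0::'a} \<times> (convex hull Y) = convex hull ({0::'a} \<times> Y)" .
  show ?thesis unfolding direct_sum_def eq1 eq by (rule hull_Un[symmetric]) (blast intro: convex_Inter)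
qed

text \<open>The generator 0 is the base case \<open>{0}\<close> and keeps the hull nonempty for
  \<open>f = 0\<close>.\<close>

lemma direct_sum_power_eq:
  "direct_sum_power f (convex hull H) = convex hull ({0} \<union> (\<Union>m<f. Poly_Mapping.single m ` H))"
proof (induction f)
  case (Suc f)
  define X where "X = {0} \<union> (\<Union>m<f. Poly_Mapping.single m ` H)"
  have "append_coord f ` (X \<times> {0}) = X" "append_coord f ` ({0} \<times> H) = Poly_Mapping.single f ` H"
    by (force simp: append_coord_def)+
  then have "append_coord f ` (X \<times> {0} \<union> {0} \<times> H) = X \<union> Poly_Mapping.single f ` H"
    by (simp add: image_Un)
  moreover have "X \<union> Poly_Mapping.single f ` H = {0} \<union> (\<Union>m<Suc f. Poly_Mapping.single m ` H)"
    by (auto simp: X_def lessThan_Suc)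
  moreover have "direct_sum_power (Suc f) (convex hull H) = append_coord f ` direct_sum (convex hull X) (convex hull H)"
    by (simp only: direct_sum_power.simps Suc X_def)
  ultimately show ?case
    by (simp only: direct_sum_hulls convex_hull_linear_image[OF linear_append_coord])
qed simp

lemma vertices_linear_image:
  assumes "linear A" "inj A"
  shows "vertices (A ` P) = A ` vertices P"
proof -
  have "A x \<in> open_segment (A a) (A b) \<longleftrightarrow> x \<in> open_segment a b" for x a b
    unfolding open_segment_linear_image[OF assms] by (rule inj_image_mem_iff[OF assms(2)])
  then show ?thesis by (auto simp: vertices_def extreme_point_of_def)
qed

section \<open>The lattice isomorphism onto a direct sum with hexagons\<close>

definition H6 :: "(real \<times> real) set" where
  "H6 = {(1, 0), (-1, 0), (0, 1), (0, -1), (1, -1), (-1, 1)}"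

text \<open>The hypotheses \<open>hp\<close> and \<open>hq\<close> say that a vertex involving
  \<open>p m\<close> or \<open>q m\<close> lies in one hexagon. The number \<open>f\<close> of
  chosen pairs is left open, so that it can be set to \<open>num_P6 d k\<close>.\<close>

locale hexagon_splitting =
  fixes d f :: nat and N P E :: "'a::euclidean_space set" and p q :: "nat \<Rightarrow> 'a" and g :: "'a \<Rightarrow> 'a \<Rightarrow> real"
  assumes P: "smooth_fano d N P" and EF: "E \<in> frames P"
    and g_lin: "linear (g e)" and g_crd: "e \<in> E \<Longrightarrow> x \<in> N \<Longrightarrow> g e x = real_of_int (crd E e x)"
    and pE: "m < f \<Longrightarrow> p m \<in> E" and qE: "m < f \<Longrightarrow> q m \<in> E"
    and inj_p: "inj_on p {..<f}" and inj_q: "inj_on q {..<f}"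
    and pq: "m < f \<Longrightarrow> n < f \<Longrightarrow> p m \<noteq> q n"
    and hp: "m < f \<Longrightarrow> {v \<in> vertices P. crd E (p m) v \<noteq> 0} = {p m, - p m, q m - p m, p m - q m}"
    and hq: "m < f \<Longrightarrow> {v \<in> vertices P. crd E (q m) v \<noteq> 0} = {q m, - q m, p m - q m, q m - p m}"
begin

lemmas D = smooth_fanoD[OF P]
lemmas bas = frame_basis_fano[OF P EF]

lemma VN: "v \<in> vertices P \<Longrightarrow> v \<in> N" using D(4) by auto

lemma EN: "e \<in> E \<Longrightarrow> e \<in> N" using lattice_basis_subset[OF bas] .

lemma g_E: "e \<in> E \<Longrightarrow> j \<in> E \<Longrightarrow> g e j = (if e = j then 1 else 0)"
  using g_crd EN crd_basis[OF bas] by auto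

lemma g_pq:
  assumes "m < f" "n < f"
  shows "g (p m) (p n) = (if m = n then 1 else 0)" "g (q m) (q n) = (if m = n then 1 else 0)"
    "g (p m) (q n) = 0" "g (q m) (p n) = 0"
  using g_E pE[OF assms(1)] qE[OF assms(1)] pE[OF assms(2)] qE[OF assms(2)] pq[OF assms] pq[OF assms(2,1)]
    inj_onD[OF inj_p, of m n] inj_onD[OF inj_q, of m n] assms
  by (auto split: if_splits)

definition pr :: "'a \<Rightarrow> 'a" where
  "pr x = x - (\<Sum>m<f. g (p m) x *\<^sub>R p m + g (q m) x *\<^sub>R q m)"

text \<open>
  The first component of \<open>A\<close> keeps everything outside the hexagons, also outside \<open>span N\<close>, so that
  \<open>A\<close> is injective on the whole space and transports extreme points.
\<close>

definition A :: "'a \<Rightarrow> 'a \<times> (nat, real \<times> real) poly_mapping" where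
  "A x = (pr x, \<Sum>m<f. Poly_Mapping.single m (g (p m) x, g (q m) x))"

definition M' :: "'a set" where
  "M' = {x \<in> N. \<forall>m<f. g (p m) x = 0 \<and> g (q m) x = 0}"

lemma linear_pr: "linear pr"
proof (rule linearI)
  show "pr (x + y) = pr x + pr y" for x y
    by (simp add: pr_def linear_add[OF g_lin] scaleR_add_left sum.distrib)
  show "pr (r *\<^sub>R x) = r *\<^sub>R pr x" for r x
    by (simp add: pr_def linear_scale[OF g_lin] scaleR_add_right scaleR_diff_right scaleR_sum_right)
qed

lemma linear_A: "linear A"
proof (rule linearI)
  show "A (x + y) = A x + A y" for x y
  proof -
    have "Poly_Mapping.single m (g (p m) (x + y), g (q m) (x + y)) =
      Poly_Mapping.single m (g (p m) x, g (q m) x) + Poly_Mapping.single m (g (p m) y, g (q m) y)" for m :: nat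
      unfolding linear_add[OF linear_single, symmetric] by (simp add: linear_add[OF g_lin])
    then show ?thesis by (simp add: A_def linear_add[OF linear_pr] sum.distrib)
  qed
  show "A (r *\<^sub>R x) = r *\<^sub>R A x" for r x
  proof -
    have "Poly_Mapping.single m (g (p m) (r *\<^sub>R x), g (q m) (r *\<^sub>R x)) =
      r *\<^sub>R Poly_Mapping.single m (g (p m) x, g (q m) x)" for m :: nat
      unfolding linear_scale[OF linear_single, symmetric] by (simp add: linear_scale[OF g_lin])
    then show ?thesis by (simp add: A_def linear_scale[OF linear_pr] scaleR_sum_right)
  qed
qed

lemma pr_fix: "\<forall>m<f. g (p m) x = 0 \<and> g (q m) x = 0 \<Longrightarrow> pr x = x"
  by (simp add: pr_def)

lemma lookup_A: "m < f \<Longrightarrow> Poly_Mapping.lookup (snd (A x)) m = (g (p m) x, g (q m) x)"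
  by (simp add: A_def lookup_sum lookup_single when_def)

lemma inj_A: "inj A"
proof (rule linear_injective_0[OF linear_A, THEN iffD2], intro allI impI)
  fix x assume "A x = 0"
  then have "\<forall>m<f. (g (p m) x, g (q m) x) = 0" using lookup_A[of _ x] by simp
  then have "pr x = x" by (intro pr_fix) (simp add: zero_prod_def)
  then show "x = 0" using \<open>A x = 0\<close> by (simp add: A_def zero_prod_def)
qed

lemma g_pr: "m < f \<Longrightarrow> g (p m) (pr x) = 0" "m < f \<Longrightarrow> g (q m) (pr x) = 0"
proof -
  assume m: "m < f"
  have "g (p m) (pr x) = g (p m) x - (\<Sum>n<f. g (p n) x * g (p m) (p n) + g (q n) x * g (p m) (q n))"
    by (simp add: pr_def linear_diff[OF g_lin] linear_sum[OF g_lin] linear_add[OF g_lin] linear_scale[OF g_lin])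
  also have "(\<Sum>n<f. g (p n) x * g (p m) (p n) + g (q n) x * g (p m) (q n)) = (\<Sum>n<f. if m = n then g (p n) x else 0)"
    by (rule sum.cong[OF refl]) (simp add: g_pq m)
  finally show "g (p m) (pr x) = 0" using m by simp
  have "g (q m) (pr x) = g (q m) x - (\<Sum>n<f. g (p n) x * g (q m) (p n) + g (q n) x * g (q m) (q n))"
    by (simp add: pr_def linear_diff[OF g_lin] linear_sum[OF g_lin] linear_add[OF g_lin] linear_scale[OF g_lin])
  also have "(\<Sum>n<f. g (p n) x * g (q m) (p n) + g (q n) x * g (q m) (q n)) = (\<Sum>n<f. if m = n then g (q n) x else 0)"
    by (rule sum.cong[OF refl]) (simp add: g_pq m)
  finally show "g (q m) (pr x) = 0" using m by simp
qed

lemma lattice_add_sum: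
  assumes "x \<in> N"
  shows "x + (\<Sum>m<f. of_int (a m) *\<^sub>R p m + of_int (b m) *\<^sub>R q m) \<in> N"
proof -
  have 1: "(\<Sum>m<f. of_int (a m) *\<^sub>R p m) \<in> N" "(\<Sum>m<f. of_int (b m) *\<^sub>R q m) \<in> N"
    using lattice_sum[OF bas, of "{..<f}" p a] lattice_sum[OF bas, of "{..<f}" q b] EN pE qE by auto
  have 2: "(\<Sum>m<f. of_int (a m) *\<^sub>R p m) + (\<Sum>m<f. of_int (b m) *\<^sub>R q m) \<in> N"
    using lattice_lincomb[OF bas 1, of 1 1] by simp
  show ?thesis using lattice_lincomb[OF bas assms 2, of 1 1] by (simp add: sum.distrib)
qed

lemma pr_N:
  assumes "x \<in> N"
  shows "pr x \<in> M'"
proof -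
  have "pr x = x + (\<Sum>m<f. of_int (- crd E (p m) x) *\<^sub>R p m + of_int (- crd E (q m) x) *\<^sub>R q m)"
    unfolding pr_def diff_conv_add_uminus sum_negf[symmetric]
    by (rule arg_cong[where f = "\<lambda>s. x + s"], rule sum.cong[OF refl]) (simp add: g_crd pE qE assms)
  then have "pr x \<in> N" using lattice_add_sum[OF assms] by metis
  then show ?thesis using g_pr by (simp add: M'_def)
qed

lemma pr_M': "x \<in> M' \<Longrightarrow> pr x = x" "M' \<subseteq> N"
  using pr_fix by (auto simp: M'_def)

lemma pr_image: "pr ` N = M'"
proof
  show "pr ` N \<subseteq> M'" using pr_N by auto
  show "M' \<subseteq> pr ` N"
  proof
    fix x assume "x \<in> M'"
    then show "x \<in> pr ` N" using pr_M' by (intro image_eqI[of x pr x]) auto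
  qed
qed

lemma A_eq_iff:
  assumes "\<And>m. m < f \<Longrightarrow> g (p m) x = a m" "\<And>m. m < f \<Longrightarrow> g (q m) x = b m" "x = y + (\<Sum>m<f. a m *\<^sub>R p m + b m *\<^sub>R q m)"
  shows "A x = (y, \<Sum>m<f. Poly_Mapping.single m (a m, b m))"
proof -
  have "(\<Sum>m<f. g (p m) x *\<^sub>R p m + g (q m) x *\<^sub>R q m) = (\<Sum>m<f. a m *\<^sub>R p m + b m *\<^sub>R q m)"
    by (rule sum.cong[OF refl]) (simp add: assms(1,2))
  then have "pr x = y" using assms(3) by (simp add: pr_def)
  moreover have "(\<Sum>m<f. Poly_Mapping.single m (g (p m) x, g (q m) x)) = (\<Sum>m<f. Poly_Mapping.single m (a m, b m))"
    by (rule sum.cong[OF refl]) (simp add: assms(1,2))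
  ultimately show ?thesis by (simp add: A_def)
qed

lemma A_image_N: "A ` N = M' \<times> lattice_power f P6_lattice"
proof (intro equalityI subsetI)
  fix z assume "z \<in> A ` N"
  then obtain x where x: "x \<in> N" "z = A x" by auto
  have "\<forall>m<f. (g (p m) x, g (q m) x) \<in> P6_lattice" using x by (simp add: P6_lattice_def g_crd pE qE)
  then have "snd (A x) \<in> lattice_power f P6_lattice" unfolding lattice_power_eq A_def snd_conv
    by (intro CollectI exI[of _ "\<lambda>m. (g (p m) x, g (q m) x)"] conjI refl)
  then show "z \<in> M' \<times> lattice_power f P6_lattice" using pr_N[OF x(1)] x(2) by (simp add: A_def)
next
  fix z assume "z \<in> M' \<times> lattice_power f P6_lattice"
  then obtain u y where z: "u \<in> M'" "\<forall>m<f. y m \<in> P6_lattice" "z = (u, \<Sum>m<f. Poly_Mapping.single m (y m))"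
    unfolding lattice_power_eq by blast
  define a b where "a m = \<lfloor>fst (y m)\<rfloor>" and "b m = \<lfloor>snd (y m)\<rfloor>" for m
  have ab: "y m = (of_int (a m), of_int (b m))" if "m < f" for m
    using z(2) that by (auto simp: P6_lattice_def a_def b_def Ints_def)
  define x where "x = u + (\<Sum>m<f. of_int (a m) *\<^sub>R p m + of_int (b m) *\<^sub>R q m)"
  have xN: "x \<in> N" unfolding x_def using z(1) pr_M'(2) by (intro lattice_add_sum) auto
  have gu: "g (p m) u = 0" "g (q m) u = 0" if "m < f" for m using z(1) that by (auto simp: M'_def)
  have gx: "g (p m) x = of_int (a m)" "g (q m) x = of_int (b m)" if m: "m < f" for m
  proof -
    have "g (p m) x = (\<Sum>n<f. of_int (a n) * g (p m) (p n) + of_int (b n) * g (p m) (q n))"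
      by (simp add: x_def linear_sum[OF g_lin] linear_add[OF g_lin] linear_scale[OF g_lin] gu m)
    also have "\<dots> = (\<Sum>n<f. if m = n then of_int (a n) else 0)"
      by (rule sum.cong[OF refl]) (simp add: g_pq m)
    finally show "g (p m) x = of_int (a m)" using m by simp
    have "g (q m) x = (\<Sum>n<f. of_int (a n) * g (q m) (p n) + of_int (b n) * g (q m) (q n))"
      by (simp add: x_def linear_sum[OF g_lin] linear_add[OF g_lin] linear_scale[OF g_lin] gu m)
    also have "\<dots> = (\<Sum>n<f. if m = n then of_int (b n) else 0)"
      by (rule sum.cong[OF refl]) (simp add: g_pq m)
    finally show "g (q m) x = of_int (b m)" using m by simp
  qed
  have "A x = (u, \<Sum>m<f. Poly_Mapping.single m (real_of_int (a m), real_of_int (b m)))"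
    by (rule A_eq_iff[OF gx x_def])
  also have "\<dots> = z" using z(3) ab by simp
  finally show "z \<in> A ` N" using xN by blast
qed

lemma A_pq:
  assumes n: "n < f"
  shows "A (p n) = (0, Poly_Mapping.single n (1, 0))" "A (q n) = (0, Poly_Mapping.single n (0, 1))"
    and pr_pq: "pr (p n) = 0" "pr (q n) = 0"
proof -
  have s: "(\<Sum>m<f. Poly_Mapping.single m (if m = n then c else 0)) = Poly_Mapping.single n c" for c :: "real \<times> real"
  proof -
    have "(\<Sum>m<f. Poly_Mapping.single m (if m = n then c else 0)) = (\<Sum>m<f. if m = n then Poly_Mapping.single n c else 0)"
      by (rule sum.cong[OF refl]) simp
    then show ?thesis using n by simp
  qed
  have "(\<Sum>m<f. g (p m) (p n) *\<^sub>R p m + g (q m) (p n) *\<^sub>R q m) = (\<Sum>m<f. if m = n then p n else 0)"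
    by (rule sum.cong[OF refl]) (simp add: g_pq n)
  then show 1: "pr (p n) = 0" using n by (simp add: pr_def)
  have "(\<Sum>m<f. g (p m) (q n) *\<^sub>R p m + g (q m) (q n) *\<^sub>R q m) = (\<Sum>m<f. if m = n then q n else 0)"
    by (rule sum.cong[OF refl]) (simp add: g_pq n)
  then show 2: "pr (q n) = 0" using n by (simp add: pr_def)
  have "(\<Sum>m<f. Poly_Mapping.single m (g (p m) (p n), g (q m) (p n))) = (\<Sum>m<f. Poly_Mapping.single m (if m = n then (1, 0) else 0))"
    by (rule sum.cong[OF refl]) (simp add: g_pq n zero_prod_def)
  then show "A (p n) = (0, Poly_Mapping.single n (1, 0))" using 1 s by (simp add: A_def)
  have "(\<Sum>m<f. Poly_Mapping.single m (g (p m) (q n), g (q m) (q n))) = (\<Sum>m<f. Poly_Mapping.single m (if m = n then (0, 1) else 0))"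
    by (rule sum.cong[OF refl]) (simp add: g_pq n zero_prod_def)
  then show "A (q n) = (0, Poly_Mapping.single n (0, 1))" using 2 s by (simp add: A_def)
qed

definition hex :: "nat \<Rightarrow> 'a set" where
  "hex m = {p m, - p m, q m, - q m, q m - p m, p m - q m}"

lemma hex_vertices: "m < f \<Longrightarrow> hex m \<subseteq> vertices P"
  using hp[of m] hq[of m] by (auto simp: hex_def)

lemma vertices_cases:
  assumes "v \<in> vertices P" "v \<notin> M'"
  obtains m where "m < f" "v \<in> hex m"
proof -
  obtain m where m: "m < f" "g (p m) v \<noteq> 0 \<or> g (q m) v \<noteq> 0" using assms VN by (auto simp: M'_def)
  then have "crd E (p m) v \<noteq> 0 \<or> crd E (q m) v \<noteq> 0"
    using g_crd pE qE VN[OF assms(1)] by auto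
  then have "v \<in> hex m" using hp[OF m(1)] hq[OF m(1)] assms(1) by (auto simp: hex_def)
  then show ?thesis using that m(1) by blast
qed

lemma pr_hex: "m < f \<Longrightarrow> v \<in> hex m \<Longrightarrow> pr v = 0"
  by (auto simp: hex_def linear_neg[OF linear_pr] linear_diff[OF linear_pr] pr_pq)

lemma A_hex:
  assumes "m < f"
  shows "A ` hex m = {0} \<times> Poly_Mapping.single m ` H6"
proof -
  have "A ` hex m = {A (p m), - A (p m), A (q m), - A (q m), A (q m) - A (p m), A (p m) - A (q m)}"
    by (simp add: hex_def linear_neg[OF linear_A] linear_diff[OF linear_A])
  also have "\<dots> = {0} \<times> Poly_Mapping.single m ` H6"
    unfolding A_pq[OF assms] H6_def
    by (auto simp: uminus_prod_def minus_prod_def single_uminus[symmetric] single_diff[symmetric])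
  finally show ?thesis .
qed

text \<open>As a linear image of \<open>P\<close>, rather than a section, \<open>Q\<close> inherits
  being a polytope, its affine hull and 0 in the relative interior.\<close>

definition Q :: "'a set" where "Q = pr ` P"

lemma Q_hull: "Q = convex hull (pr ` vertices P)"
  unfolding Q_def using convex_hull_linear_image[OF linear_pr] polytope_hull_vertices(1)[OF D(2)] by metis

text \<open>Compare generators: vertices in \<open>M'\<close> go to the first factor, hexagons to
  the second. The projections of hexagon vertices and the base point of the power contribute only 0,
  which lies in both hulls because 0 is in \<open>P\<close>.\<close>

lemma A_image_P: "A ` P = direct_sum Q (direct_sum_power f P6)"
proof -
  define X Y where "X = pr ` vertices P" and "Y = {0} \<union> (\<Union>m<f. Poly_Mapping.single m ` H6)"
  have A_M': "A v = (v, 0)" if "v \<in> M'" for v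
    using that pr_M'(1)[OF that] by (simp add: A_def M'_def zero_prod_def[symmetric])
  have "insert 0 (A ` vertices P) = X \<times> {0} \<union> {0} \<times> Y"
  proof (intro equalityI subsetI)
    fix z assume "z \<in> insert 0 (A ` vertices P)"
    then consider "z = 0" | v where "v \<in> vertices P" "z = A v" by auto
    then show "z \<in> X \<times> {0} \<union> {0} \<times> Y"
    proof cases
      case 1
      then show ?thesis by (simp add: Y_def zero_prod_def)
    next
      case 2
      show ?thesis
      proof (cases "v \<in> M'")
        case True
        then have "z = (pr v, 0)" using 2 A_M' pr_M'(1) by simp
        then show ?thesis using 2(1) by (simp add: X_def)
      next
        case False
        then obtain m where m: "m < f" "v \<in> hex m" using vertices_cases[OF 2(1)] by blast
        then have "z \<in> {0} \<times> Poly_Mapping.single m ` H6" using A_hex 2(2) by blast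
        then show ?thesis using m(1) by (auto simp: Y_def)
      qed
    qed
  next
    fix z assume "z \<in> X \<times> {0} \<union> {0} \<times> Y"
    then consider v where "v \<in> vertices P" "z = (pr v, 0)" | "z = 0" | m where "m < f" "z \<in> {0} \<times> Poly_Mapping.single m ` H6"
      by (auto simp: X_def Y_def zero_prod_def)
    then show "z \<in> insert 0 (A ` vertices P)"
    proof cases
      case 1
      show ?thesis
      proof (cases "v \<in> M'")
        case True
        then have "z = A v" using 1 A_M' pr_M'(1) by simp
        then show ?thesis using 1 by blast
      next
        case False
        then obtain m where "m < f" "v \<in> hex m" using vertices_cases[OF 1(1)] by blast
        then show ?thesis using pr_hex 1 by (simp add: zero_prod_def)
      qed
    next
      case 3
      then have "z \<in> A ` hex m" using A_hex by blast
      then show ?thesis using hex_vertices[OF 3(1)] by blast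
    qed simp
  qed
  moreover have "convex hull (insert 0 (A ` vertices P)) = convex hull (A ` vertices P)"
  proof (rule hull_redundant)
    have "0 \<in> P" using D(5) rel_interior_subset by blast
    then have "A 0 \<in> A ` (convex hull (vertices P))" using polytope_hull_vertices(1)[OF D(2)] by simp
    then show "0 \<in> convex hull (A ` vertices P)"
      by (simp add: linear_0[OF linear_A] convex_hull_linear_image[OF linear_A])
  qed
  moreover have "A ` P = convex hull (A ` vertices P)"
    using convex_hull_linear_image[OF linear_A] polytope_hull_vertices(1)[OF D(2)] by metis
  moreover have "direct_sum_power f P6 = convex hull Y"
    unfolding P6_def Y_def H6_def by (rule direct_sum_power_eq)
  ultimately show ?thesis by (simp add: Q_hull X_def[symmetric] direct_sum_hulls)
qed

lemma equivalent: "lattice_equivalent N P (M' \<times> lattice_power f P6_lattice) (direct_sum Q (direct_sum_power f P6))"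
  unfolding lattice_equivalent_def
proof (intro exI[of _ A] exI[of _ 0] conjI)
  show "linear A" by (rule linear_A)
  have inj: "inj_on A S" for S using inj_A by (rule inj_on_subset) simp
  show "bij_betw (\<lambda>x. A x + 0) N (M' \<times> lattice_power f P6_lattice)"
    using A_image_N inj by (simp add: bij_betw_def)
  show "bij_betw (\<lambda>x. A x + 0) (vertices P) (vertices (direct_sum Q (direct_sum_power f P6)))"
    using vertices_linear_image[OF linear_A inj_A, of P] inj by (simp add: bij_betw_def A_image_P)
qed

section \<open>The complementary summand is a smooth Fano polytope\<close>

definition W :: "'a set" where "W = p ` {..<f} \<union> q ` {..<f}"

lemma W: "W \<subseteq> E" "finite W" "card W = 2 * f"
proof -
  show "W \<subseteq> E" "finite W" using pE qE by (auto simp: W_def)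
  have "p ` {..<f} \<inter> q ` {..<f} = {}" using pq by auto
  then show "card W = 2 * f"
    using card_image[OF inj_p] card_image[OF inj_q] by (simp add: W_def card_Un_disjoint)
qed

lemma basis_E: "finite E" "independent E"
  using bas by (auto simp: lattice_basis_def)

lemma M'_iff: "x \<in> M' \<longleftrightarrow> x \<in> N \<and> (\<forall>w\<in>W. crd E w x = 0)"
  using g_crd pE qE by (auto simp: M'_def W_def)

lemma basis_M': "lattice_basis (E - W) M'"
  unfolding lattice_basis_def
proof (intro conjI set_eqI iffI)
  show "finite (E - W)" using basis_E(1) by simp
  show "independent (E - W)" by (rule independent_mono[OF basis_E(2)]) blast
  fix x
  assume "x \<in> M'"
  then have x: "x \<in> N" "\<And>w. w \<in> W \<Longrightarrow> crd E w x = 0" by (auto simp: M'_iff)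
  have "x = (\<Sum>e\<in>E. of_int (crd E e x) *\<^sub>R e)" using lattice_basis_crd[OF bas x(1)] .
  also have "\<dots> = (\<Sum>e\<in>E - W. of_int (crd E e x) *\<^sub>R e)"
    using basis_E x(2) by (intro sum.mono_neutral_right) auto
  finally show "x \<in> {x. \<exists>c. x = (\<Sum>b\<in>E - W. real_of_int (c b) *\<^sub>R b)}"
    by (intro CollectI exI[of _ "\<lambda>e. crd E e x"])
next
  fix x assume "x \<in> {x. \<exists>c. x = (\<Sum>b\<in>E - W. real_of_int (c b) *\<^sub>R b)}"
  then obtain c where c: "x = (\<Sum>b\<in>E - W. real_of_int (c b) *\<^sub>R b)" by blast
  define c' where "c' b = (if b \<in> W then 0 else c b)" for b
  have x: "x = (\<Sum>b\<in>E. real_of_int (c' b) *\<^sub>R b)"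
    unfolding c using basis_E by (intro sum.mono_neutral_cong_left) (auto simp: c'_def)
  have "x \<in> N" unfolding x by (rule lattice_basis_memI[OF bas])
  moreover have "crd E w x = 0" if "w \<in> W" for w
    using crd_unique[OF bas x, of w] that W(1) by (auto simp: c'_def)
  ultimately show "x \<in> M'" by (simp add: M'_iff)
qed

lemma rank_M': "lattice_of_rank (d - 2 * f) M'"
proof -
  have "card E = d" using lattice_of_rank_card[OF D(1) bas] .
  then have "card (E - W) = d - 2 * f" using W by (simp add: card_Diff_subset)
  then show ?thesis using basis_M' unfolding lattice_of_rank_def by blast
qed

lemma pr_vertices: "v \<in> vertices P \<Longrightarrow> pr v \<in> M'"
  using pr_N VN by blast

lemma polytope_Q: "polytope Q"
  unfolding Q_def by (rule polytope_linear_image[OF linear_pr D(2)])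

lemma affine_hull_Q: "affine hull Q = span M'"
proof -
  have "affine hull Q = pr ` (affine hull P)"
    unfolding Q_def by (rule affine_hull_linear_image[symmetric]) (rule linear_conv_bounded_linear[THEN iffD1, OF linear_pr])
  also have "\<dots> = span (pr ` N)"
    unfolding D(3) by (rule linear_span_image[OF linear_pr, symmetric])
  finally show ?thesis by (simp add: pr_image)
qed

lemma rel_interior_Q: "0 \<in> rel_interior Q"
proof -
  have "pr 0 \<in> pr ` rel_interior P" using D(5) by (rule imageI)
  then show ?thesis
    unfolding Q_def rel_interior_convex_linear_image[OF linear_pr polytope_imp_convex[OF D(2)]]
    by (simp add: linear_0[OF linear_pr])
qed

lemma vertices_Q: "vertices Q \<subseteq> pr ` vertices P"
  using extreme_point_of_convex_hull[of _ "pr ` vertices P"] by (auto simp: vertices_def Q_hull)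

lemma g_W: "w \<in> W \<Longrightarrow> x \<in> N \<Longrightarrow> g w x = of_int (crd E w x)"
  using g_crd W(1) by blast

text \<open>A facet of \<open>Q\<close> joined with the simplex on \<open>W\<close> is a facet of \<open>P\<close>.\<close>

lemma facet_Q:
  assumes F: "F facet_of Q"
  shows "lattice_basis (vertices F) M'"
proof -
  obtain a where a: "linear a" "\<And>x. x \<in> Q \<Longrightarrow> a x \<le> (1::real)" "F = Q \<inter> {x. a x = 1}" "span F = span M'"
    using facet_functional[OF polytope_Q affine_hull_Q rel_interior_Q F] by blast
  \<comment> \<open>On \<open>M'\<close> this is \<open>a\<close>; on hexagon vertices
    \<open>pr\<close> vanishes and \<open>u\<close> is the coordinate sum in \<open>E\<close>, that
    is, 1 minus the depth. So \<open>u\<close> is at most 1 on every vertex of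
    \<open>P\<close>.\<close>
  define u where "u x = a (pr x) + (\<Sum>w\<in>W. g w x)" for x
  have lin: "linear u"
    unfolding u_def by (intro linear_compose_add linear_compose_sum linear_compose[OF linear_pr a(1), unfolded o_def] ballI g_lin)
  have VQ: "pr v \<in> Q" if "v \<in> vertices P" for v
    using that by (auto simp: Q_def vertices_def extreme_point_of_def)
  have uM: "u v = a v" if "v \<in> M'" for v
    using that g_W pr_M'(1)[OF that] by (auto simp: u_def M'_iff)
  interpret fano_frames N "vertices P" "frames P" by (rule fano_frames_frames[OF P])
  have hexE: "crd E e v = 0" if v: "v \<in> vertices P" "v \<notin> M'" and e: "e \<in> E - W" for v e
  proof -
    obtain m where m: "m < f" "v \<in> hex m" by (rule vertices_cases[OF v])
    have "p m \<in> E" "q m \<in> E" "e \<noteq> p m" "e \<noteq> q m" "e \<in> E" using m pE qE e by (auto simp: W_def)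
    then show ?thesis
      using m(2) by (auto simp: hex_def crd_frame[OF EF] crd_neg_frame[OF EF] crd_difference[OF EF])
  qed
  have uhex: "u v = 1 - real_of_int (depth E v)" if v: "v \<in> vertices P" "v \<notin> M'" for v
  proof -
    obtain m where m: "m < f" "v \<in> hex m" by (rule vertices_cases[OF v])
    have "u v = (\<Sum>w\<in>W. real_of_int (crd E w v))"
      unfolding u_def pr_hex[OF m] linear_0[OF a(1)] using g_W VN[OF v(1)] by simp
    also have "\<dots> = (\<Sum>w\<in>E. real_of_int (crd E w v))"
      using basis_E W(1) hexE[OF v] by (intro sum.mono_neutral_left) auto
    finally show ?thesis by (simp add: depth_def)
  qed
  define R where "R = {v \<in> vertices P. v \<in> M' \<and> a v = 1}"
  define S where "S = {v \<in> vertices P. u v = 1}"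
  have WM: "w \<in> vertices P" "w \<notin> M'" "u w = 1" if "w \<in> W" for w
  proof -
    have wE: "w \<in> E" using that W(1) by auto
    then show "w \<in> vertices P" using frame_subset[OF EF] by auto
    have "crd E w w = 1" using crd_frame[OF EF wE wE] by simp
    then show "w \<notin> M'" using that M'_iff[of w] by auto
    then show "u w = 1" using uhex[OF \<open>w \<in> vertices P\<close>] depth_frame[OF EF wE] by simp
  qed
  have SRW: "S = R \<union> W"
  proof (intro equalityI subsetI)
    fix v assume v: "v \<in> S"
    show "v \<in> R \<union> W"
    proof (cases "v \<in> M'")
      case True
      then show ?thesis using v uM by (simp add: R_def S_def)
    next
      case False
      then have "depth E v = 0" "v \<in> vertices P" using v uhex by (auto simp: S_def)
      then have vE: "v \<in> E" using depth_0D[OF EF] by blast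
      then have "v \<in> W" using hexE[OF \<open>v \<in> vertices P\<close> False, of v] crd_frame[OF EF vE vE] by auto
      then show ?thesis by simp
    qed
  next
    fix v assume "v \<in> R \<union> W"
    then show "v \<in> S" using WM uM by (auto simp: R_def S_def)
  qed
  have ule: "u v \<le> 1" if "v \<in> vertices P" for v
  proof (cases "v \<in> M'")
    case True
    then show ?thesis using uM a(2)[OF VQ[OF that]] pr_M'(1) by simp
  next
    case False
    then show ?thesis using uhex[OF that] depth_nonneg[OF EF that] by simp
  qed
  have face: "F face_of Q" "F \<noteq> {}" using F by (auto simp: facet_of_def)
  have Fhull: "F = convex hull (vertices F)"
    by (rule polytope_hull_vertices(1)[OF face_of_polytope_polytope[OF polytope_Q face(1)]])
  have FR: "vertices F \<subseteq> R"
  proof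
    fix x assume "x \<in> vertices F"
    then have x: "x \<in> vertices Q" "a x = 1" using vertices_face[OF face(1)] a(3) by auto
    then obtain v where v: "v \<in> vertices P" "x = pr v" using vertices_Q by auto
    have "v \<in> M'"
    proof (rule ccontr)
      assume "v \<notin> M'"
      then obtain m where "m < f" "v \<in> hex m" by (rule vertices_cases[OF v(1)])
      then show False using x(2) v(2) pr_hex linear_0[OF a(1)] by simp
    qed
    then show "x \<in> R" using v x(2) pr_M'(1) by (simp add: R_def)
  qed
  have sF: "span M' \<subseteq> span (vertices F)"
    using a(4) span_convex_hull[of "vertices F"] Fhull by simp
  have "N \<subseteq> span S"
  proof
    fix x assume x: "x \<in> N"
    have "pr x \<in> span M'" using pr_N[OF x] by (rule span_base)
    then have "pr x \<in> span S" using sF span_mono[of "vertices F" S] FR SRW by blast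
    moreover have "(\<Sum>m<f. g (p m) x *\<^sub>R p m + g (q m) x *\<^sub>R q m) \<in> span S"
      by (intro span_sum span_add span_scale span_base) (auto simp: SRW W_def)
    ultimately have "pr x + (\<Sum>m<f. g (p m) x *\<^sub>R p m + g (q m) x *\<^sub>R q m) \<in> span S" by (rule span_add)
    then show "x \<in> span S" by (simp add: pr_def)
  qed
  then have "span N \<subseteq> span S" by (rule span_minimal[OF _ subspace_span])
  moreover have "span S \<subseteq> span N" using VN by (intro span_mono) (auto simp: S_def)
  ultimately have spS: "span {v \<in> vertices P. u v = 1} = span N" by (simp add: S_def)
  have "vertices F \<noteq> {}" using Fhull face(2) by force
  then have ne: "\<exists>v\<in>vertices P. u v = 1" using FR SRW by (auto simp: S_def R_def)
  have bS: "lattice_basis S N"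
    unfolding S_def by (rule frame_basis_fano[OF P frame_of_functional[OF P lin ule spS ne]])
  then have indS: "finite S" "independent S" by (auto simp: lattice_basis_def)
  \<comment> \<open>A further point of \<open>R\<close> would lie in \<open>F\<close>, hence in the
    span of the vertices of \<open>F\<close>, against the independence of \<open>S\<close>.\<close>
  have RF: "R = vertices F"
  proof (rule ccontr)
    assume "R \<noteq> vertices F"
    then obtain s where s: "s \<in> R" "s \<notin> vertices F" using FR by blast
    have "s \<in> Q" using s(1) VQ[of s] pr_M'(1)[of s] by (simp add: R_def)
    then have "s \<in> F" using s(1) a(3) by (simp add: R_def)
    then have "s \<in> span (vertices F)" using Fhull convex_hull_subset_span by blast
    moreover have "vertices F \<subseteq> S - {s}" using FR SRW s by blast
    ultimately have "s \<in> span (S - {s})" using span_mono by blast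
    then show False using indS(2) s(1) SRW by (auto simp: dependent_def)
  qed
  have disj: "R \<inter> W = {}" using WM by (auto simp: R_def)
  have "lattice_basis R M'"
    unfolding lattice_basis_def
  proof (intro conjI set_eqI iffI)
    show "finite R" using indS(1) SRW by simp
    show "independent R" by (rule independent_mono[OF indS(2)]) (simp add: SRW)
    fix x
    assume x: "x \<in> M'"
    \<comment> \<open>Projecting the expansion in \<open>S\<close> fixes \<open>x\<close> and the
      elements of \<open>R\<close> and kills those of \<open>W\<close>, so the integer coefficients
      on \<open>R\<close> remain.\<close>
    have "x = pr (\<Sum>s\<in>S. of_int (crd S s x) *\<^sub>R s)"
      using lattice_basis_crd[OF bS] x pr_M' by auto
    also have "\<dots> = (\<Sum>s\<in>S. of_int (crd S s x) *\<^sub>R pr s)"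
      by (simp add: linear_sum[OF linear_pr] linear_scale[OF linear_pr])
    also have "\<dots> = (\<Sum>s\<in>R. of_int (crd S s x) *\<^sub>R s)"
    proof (rule sum.mono_neutral_cong_right)
      show "\<forall>s\<in>S - R. of_int (crd S s x) *\<^sub>R pr s = 0"
        using SRW pr_pq by (auto simp: W_def)
      show "of_int (crd S s x) *\<^sub>R pr s = of_int (crd S s x) *\<^sub>R s" if "s \<in> R" for s
        using that pr_M'(1)[of s] by (simp add: R_def)
    qed (use indS SRW in auto)
    finally show "x \<in> {x. \<exists>c. x = (\<Sum>b\<in>R. real_of_int (c b) *\<^sub>R b)}"
      by (intro CollectI exI[of _ "\<lambda>s. crd S s x"])
  next
    fix x assume "x \<in> {x. \<exists>c. x = (\<Sum>b\<in>R. real_of_int (c b) *\<^sub>R b)}"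
    then obtain c where c: "x = (\<Sum>b\<in>R. real_of_int (c b) *\<^sub>R b)" by blast
    have RM: "b \<in> M'" if "b \<in> R" for b using that by (simp add: R_def)
    then have "b \<in> N" if "b \<in> R" for b using that pr_M'(2) by blast
    then have "x \<in> N" unfolding c by (rule lattice_sum[OF bas])
    moreover have "g (p m) x = 0" "g (q m) x = 0" if "m < f" for m
      using RM that by (auto simp: c linear_sum[OF g_lin] linear_scale[OF g_lin] M'_def)
    ultimately show "x \<in> M'" by (simp add: M'_def)
  qed
  then show ?thesis by (simp add: RF)
qed

lemma smooth_fano_Q: "smooth_fano (d - 2 * f) M' Q"
  unfolding smooth_fano_def
  using rank_M' polytope_Q affine_hull_Q rel_interior_Q facet_Q vertices_Q pr_vertices by blast

end

text \<open>Greedy choice: \<open>f\<close> chosen representatives and their partners block at most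
  \<open>2 * f\<close> elements of \<open>M\<close>.\<close>

lemma involution_pairs:
  assumes fin: "finite M" and inv: "\<And>l. l \<in> M \<Longrightarrow> \<phi> l \<in> M \<and> \<phi> l \<noteq> l \<and> \<phi> (\<phi> l) = l"
    and card: "2 * f \<le> card M"
  shows "\<exists>p. inj_on p {..<f::nat} \<and> (\<forall>m<f. p m \<in> M) \<and> (\<forall>m<f. \<forall>n<f. p m \<noteq> \<phi> (p n))"
  using card
proof (induction f)
  case (Suc f)
  then obtain p where p: "inj_on p {..<f}" "\<And>m. m < f \<Longrightarrow> p m \<in> M" "\<And>m n. m < f \<Longrightarrow> n < f \<Longrightarrow> p m \<noteq> \<phi> (p n)"
    by force
  define W where "W = p ` {..<f} \<union> (\<lambda>m. \<phi> (p m)) ` {..<f}"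
  have "card W \<le> card (p ` {..<f}) + card ((\<lambda>m. \<phi> (p m)) ` {..<f})"
    unfolding W_def by (rule card_Un_le)
  moreover have "card (p ` {..<f}) \<le> f" "card ((\<lambda>m. \<phi> (p m)) ` {..<f}) \<le> f"
    using card_image_le[of "{..<f}" p] card_image_le[of "{..<f}" "\<lambda>m. \<phi> (p m)"] by simp_all
  ultimately have "card W \<le> f + f" by simp
  then have "card W < card M" using Suc.prems by simp
  then have "\<not> M \<subseteq> W" using card_mono[of W M] by (auto simp: W_def)
  then obtain x where x: "x \<in> M" "x \<notin> W" by blast
  have x1: "x \<noteq> p m" "x \<noteq> \<phi> (p m)" if "m < f" for m
    using x(2) that by (auto simp: W_def)
  have x2: "p m \<noteq> \<phi> x" if "m < f" for m
    using x1(2)[OF that] inv[OF x(1)] by metis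
  show ?case
  proof (intro exI[of _ "p(f := x)"] conjI allI impI)
    show "inj_on (p(f := x)) {..<Suc f}"
      using p(1) x(2) unfolding W_def lessThan_Suc by (auto simp: inj_on_fun_updI)
    show "(p(f := x)) m \<in> M" if "m < Suc f" for m using that p(2) x by (auto simp: less_Suc_eq)
    show "(p(f := x)) m \<noteq> \<phi> ((p(f := x)) n)" if "m < Suc f" "n < Suc f" for m n
      using that p(3) x1(2) x2 inv[OF x(1)] by (auto simp: less_Suc_eq)
  qed
qed simp

lemma num_P6_le:
  assumes "d \<ge> 15 * k\<^sup>2 + 37 * k"
  shows "2 * num_P6 d k + 15 * k\<^sup>2 + 37 * k \<le> d"
proof -
  define t where "t = (real d - 15 * (real k)\<^sup>2 - 37 * real k) / 2"
  have "real d \<ge> real (15 * k\<^sup>2 + 37 * k)" using assms by (rule of_nat_mono)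
  then have "0 \<le> t" by (simp add: t_def)
  then have "real (num_P6 d k) \<le> t" by (simp add: num_P6_def t_def[symmetric])
  then have "real (2 * num_P6 d k + 15 * k\<^sup>2 + 37 * k) \<le> real d" by (simp add: t_def field_simps)
  then show ?thesis by (simp only: of_nat_le_iff)
qed

theorem theorem5:
  fixes N P :: "'a::euclidean_space set" and d k :: nat
  assumes "smooth_fano d N P"
    and "card (vertices P) = 3 * d - k"
    and "d \<ge> 15 * k\<^sup>2 + 37 * k + 2"
  shows "\<exists>(M :: 'a set) (Q :: 'a set).
           smooth_fano (d - 2 * num_P6 d k) M Q \<and>
           lattice_equivalent N P
             (M \<times> lattice_power (num_P6 d k) P6_lattice)
             (direct_sum Q (direct_sum_power (num_P6 d k) P6))"
proof -
  define f where "f = num_P6 d k"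
  \<comment> \<open>\<open>k \<le> d\<close> makes the truncated difference \<open>3 * d - k\<close>
    a true one.\<close>
  have d: "0 < d" "k \<le> d" using assms(3) by auto
  obtain E where E: "E \<in> frames P" and special: "\<And>e. e \<in> E \<Longrightarrow> 0 \<le> (\<Sum>v\<in>vertices P. crd E e v)"
    using special_frame_exists[OF assms(1) d(1)] by blast
  note bas = frame_basis_fano[OF assms(1) E]
  have cE: "card E = d" using lattice_of_rank_card[OF smooth_fanoD(1)[OF assms(1)] bas] .
  interpret fr: fano_frames N "vertices P" "frames P" by (rule fano_frames_frames[OF assms(1)])
  interpret sp: special_frame N "vertices P" "frames P" E "int k"
  proof
    show "int (card (vertices P)) = 3 * int (card E) - int k" using assms(2) d cE by simp
  qed (use E special zero_not_vertex[OF assms(1) d(1)] in auto)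
  obtain M \<phi> where M: "M \<subseteq> E" "int (card (E - M)) \<le> 12 * (int k)\<^sup>2 + 22 * int k"
    and \<phi>: "\<And>l. l \<in> M \<Longrightarrow> \<phi> l \<in> M \<and> \<phi> l \<noteq> l \<and> \<phi> (\<phi> l) = l"
    and V: "\<And>l. l \<in> M \<Longrightarrow> {v \<in> vertices P. crd E l v \<noteq> 0} = {l, - l, \<phi> l - l, l - \<phi> l}"
    using sp.hexagonal_pairs by blast
  have finE: "finite E" using bas by (simp add: lattice_basis_def)
  then have finM: "finite M" using M(1) finite_subset by blast
  have "int (card (E - M)) \<le> int (12 * k\<^sup>2 + 22 * k)" using M(2) by simp
  then have "card (E - M) \<le> 12 * k\<^sup>2 + 22 * k" by (simp only: of_nat_le_iff)
  moreover have "card (E - M) = d - card M" using M(1) finM cE by (simp add: card_Diff_subset)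
  moreover have "2 * f + 15 * k\<^sup>2 + 37 * k \<le> d" unfolding f_def using assms(3) by (intro num_P6_le) simp
  \<comment> \<open>The loss \<open>12 * k\<^sup>2 + 22 * k\<close> stays below the
    \<open>15 * k\<^sup>2 + 37 * k\<close> set aside in the definition of
    \<open>num_P6\<close>.\<close>
  ultimately have "2 * f \<le> card M" by simp
  from involution_pairs[OF finM \<phi> this]
  obtain p where p: "inj_on p {..<f}" "\<And>m. m < f \<Longrightarrow> p m \<in> M" "\<And>m n. m < f \<Longrightarrow> n < f \<Longrightarrow> p m \<noteq> \<phi> (p n)"
    by blast
  define q where "q m = \<phi> (p m)" for m
  obtain g :: "'a \<Rightarrow> 'a \<Rightarrow> real" where g: "\<And>e. linear (g e)" "\<And>e x. e \<in> E \<Longrightarrow> x \<in> N \<Longrightarrow> g e x = real_of_int (crd E e x)"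
    using dual_functionals[OF bas] by blast
  have pq: "q m \<in> M" "\<phi> (q m) = p m" if "m < f" for m using p(2)[OF that] \<phi> by (auto simp: q_def)
  interpret hexagon_splitting d f N P E p q g
  proof (rule hexagon_splitting.intro)
    show "inj_on q {..<f}"
    proof (rule inj_onI)
      fix m n assume "m \<in> {..<f}" "n \<in> {..<f}" "q m = q n"
      then show "m = n" using pq(2)[of m] pq(2)[of n] inj_onD[OF p(1), of m n] by simp
    qed
    show "{v \<in> vertices P. crd E (p m) v \<noteq> 0} = {p m, - p m, q m - p m, p m - q m}" if "m < f" for m
      using V[OF p(2)[OF that]] by (simp add: q_def)
    show "{v \<in> vertices P. crd E (q m) v \<noteq> 0} = {q m, - q m, p m - q m, q m - p m}" if "m < f" for m
      using V[OF pq(1)[OF that]] pq(2)[OF that] by simp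
  qed (use assms(1) E g p pq M(1) in \<open>auto simp: q_def\<close>)
  show ?thesis
    using smooth_fano_Q equivalent unfolding f_def by blast
qed

end
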